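(* Let $K$ and $L$ be two simplicial complexes such that $K\cap L=\langle\sigma\rangle$ is the simplicial complex consisting of a set $\sigma$ and all of its subsets, and label the vertices so that the vertex set of $K\cup L$ is $[n]$. Then for every $i>0$ and every subset $S\subseteq[n]$, $$|I_{S}^{i}\cap \Delta(K\cup L)|=|I_{S}^{i}\cap\Delta(K)|+|I_{S}^{i}\cap\Delta(L)|-|I_{S}^{i}\cap 2^{[|\sigma|]}|,$$ where $2^{[|\sigma|]}=\Delta(\langle\sigma\rangle)$ is the family of all subsets of $\{1,\dots,|\sigma|\}$.
   Context: Simplicial complexes are finite and contain the empty set. For a complex $K$, $K_0$ denotes its vertex set. $[n]=\{1,\dots,n\}$. Lexicographic order: for sets $S\ne T$ of positive integers of equal size, $S<_L T$ iff $\min(S\triangle T)\in S$. Algebraic shifting (exterior): let $K$ be a simplicial complex with vertex set contained in $[n]$ (label the vertices by positive integers if necessary). Let $V$ be a real vector space with basis $e_1,\dots,e_n$, and let $f_i=\sum_{j=1}^n\alpha_{ij}e_j$, $1\le i\le n$, where the $n^2$ real numbers $\alpha_{ij}$ are algebraically independent over $\mathbb{Q}$. For $S=\{s_1<\dots<s_k\}\subseteq[n]$ put $e_S=e_{s_1}\wedge\dots\wedge e_{s_k}$, $f_S=f_{s_1}\wedge\dots\wedge f_{s_k}$ in $\bigwedge V$, and let $\tilde f_S$ be the image of $f_S$ in $(\bigwedge V)/(e_T: T\subseteq[n],\,T\notin K)$. Then $$\Delta(K)=\{S\subseteq[n]:\ \tilde f_S\notin \mathrm{span}\{\tilde f_{S'}: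 |S'|=|S|,\ S'<_L S\}\}.$$ $\Delta(K)$ does not depend on the choice of the generic matrix, of $n$, or of the vertex labelling; it is a simplicial complex with vertex set $\{1,\dots,|K_0|\}$. For a finite set $T$ of positive integers, $\mathrm{init}_j(T)$ is the set of the $j$ smallest elements of $T$. For $i>0$ and $S\subseteq[n]$, $I_S^i=\{T\subseteq[n]: |T|=|S|+i,\ \mathrm{init}_{|S|}(T)=S\}$. *)

theory Defs
  imports "HOL-Analysis.Finite_Function_Topology"
begin

section \<open>Simplicial complexes\<close>

definition simplicial_complex :: "nat set set \<Rightarrow> bool" where
  "simplicial_complex K \<longleftrightarrow>
     finite K \<and> {} \<in> K \<and> (\<forall>S\<in>K. finite S \<and> (\<forall>T\<subseteq>S. T \<in> K))"

definition vertices :: "nat set set \<Rightarrow> nat set" where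
  "vertices K = {v. {v} \<in> K}"

text \<open>Only meant for distinct finite sets of equal size.\<close>

definition lex_less :: "nat set \<Rightarrow> nat set \<Rightarrow> bool" where
  "lex_less S T \<longleftrightarrow> S \<noteq> T \<and> Min ((S - T) \<union> (T - S)) \<in> S"

definition init :: "nat \<Rightarrow> nat set \<Rightarrow> nat set" where
  "init j T = set (take j (sorted_list_of_set T))"

definition Iset :: "nat \<Rightarrow> nat \<Rightarrow> nat set \<Rightarrow> nat set set" where
  "Iset n i S = {T. T \<subseteq> {1..n} \<and> card T = card S + i \<and> init (card S) T = S}"

section \<open>Algebraic independence over the rationals\<close>

text \<open>A polynomial in variables indexed by \<open>'i\<close> is a finitely supported map from monomials
  (finitely supported exponent vectors \<open>'i \<Rightarrow>\<^sub>0 nat\<close>) to coefficients.\<close>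

definition poly_eval :: "('i \<Rightarrow> real) \<Rightarrow> (('i \<Rightarrow>\<^sub>0 nat) \<Rightarrow>\<^sub>0 rat) \<Rightarrow> real" where
  "poly_eval a p =
     (\<Sum>m\<in>Poly_Mapping.keys p. of_rat (Poly_Mapping.lookup p m) *
        (\<Prod>x\<in>Poly_Mapping.keys m. a x ^ Poly_Mapping.lookup m x))"

definition alg_independent :: "'i set \<Rightarrow> ('i \<Rightarrow> real) \<Rightarrow> bool" where
  "alg_independent I a \<longleftrightarrow>
     (\<forall>p. (\<forall>m\<in>Poly_Mapping.keys p. Poly_Mapping.keys m \<subseteq> I) \<longrightarrow> poly_eval a p = 0 \<longrightarrow> p = 0)"

definition generic :: "nat \<Rightarrow> (nat \<Rightarrow> nat \<Rightarrow> real) \<Rightarrow> bool" where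
  "generic n \<alpha> \<longleftrightarrow> alg_independent ({1..n} \<times> {1..n}) (\<lambda>(i, j). \<alpha> i j)"

section \<open>The exterior algebra\<close>

text \<open>An element of the exterior algebra on \<open>e\<^sub>1, e\<^sub>2, \<dots>\<close> is represented by its
  coordinates: \<open>Poly_Mapping.single S 1\<close> stands for the basis vector \<open>e\<^sub>S\<close>.  The product is the
  bilinear extension of \<open>e\<^sub>S \<and> e\<^sub>T = \<plusminus> e\<^bsub>S \<union> T\<^esub>\<close> for disjoint \<open>S\<close>, \<open>T\<close> (and \<open>0\<close> otherwise),
  the sign being that of the permutation that sorts \<open>S\<close> followed by \<open>T\<close>.\<close>

type_synonym ext = "nat set \<Rightarrow>\<^sub>0 real"

definition ext_alg :: "nat \<Rightarrow> ext set" where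
  "ext_alg n = {x. Poly_Mapping.keys x \<subseteq> Pow {1..n}}"

definition ext_sign :: "nat set \<Rightarrow> nat set \<Rightarrow> real" where
  "ext_sign S T = (-1) ^ card {(s, t). s \<in> S \<and> t \<in> T \<and> t < s}"

definition wedge :: "ext \<Rightarrow> ext \<Rightarrow> ext" where
  "wedge x y =
     (\<Sum>S\<in>Poly_Mapping.keys x. \<Sum>T\<in>Poly_Mapping.keys y.
        if S \<inter> T = {}
        then Poly_Mapping.single (S \<union> T)
               (ext_sign S T * Poly_Mapping.lookup x S * Poly_Mapping.lookup y T)
        else 0)"

text \<open>\<open>wedge_over v {s\<^sub>1 < \<dots> < s\<^sub>k}\<close> is \<open>v s\<^sub>1 \<and> \<dots> \<and> v s\<^sub>k\<close>.\<close>

definition wedge_over :: "(nat \<Rightarrow> ext) \<Rightarrow> nat set \<Rightarrow> ext" where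
  "wedge_over v S = foldr wedge (map v (sorted_list_of_set S)) (Poly_Mapping.single {} 1)"

definition evec :: "nat \<Rightarrow> ext" where
  "evec i = Poly_Mapping.single {i} 1"

definition fvec :: "nat \<Rightarrow> (nat \<Rightarrow> nat \<Rightarrow> real) \<Rightarrow> nat \<Rightarrow> ext" where
  "fvec n \<alpha> i = (\<Sum>j=1..n. \<alpha> i j *\<^sub>R evec j)"

definition ext_ideal :: "nat \<Rightarrow> ext set \<Rightarrow> bool" where
  "ext_ideal n J \<longleftrightarrow> J \<subseteq> ext_alg n \<and> subspace J \<and>
     (\<forall>a\<in>ext_alg n. \<forall>x\<in>J. wedge a x \<in> J \<and> wedge x a \<in> J)"

definition nonface_ideal :: "nat \<Rightarrow> nat set set \<Rightarrow> ext set" where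
  "nonface_ideal n K =
     \<Inter>{J. ext_ideal n J \<and> (\<forall>T. T \<subseteq> {1..n} \<longrightarrow> T \<notin> K \<longrightarrow> wedge_over evec T \<in> J)}"

section \<open>Algebraic shifting\<close>

text \<open>The image of \<open>x\<close> in the quotient by \<open>J\<close> is the coset \<open>x + J\<close>, and the span of the
  images of some vectors is the image of their span.\<close>

definition ext_coset :: "ext set \<Rightarrow> ext \<Rightarrow> ext set" where
  "ext_coset J x = (\<lambda>y. x + y) ` J"

definition alg_shift :: "nat \<Rightarrow> (nat \<Rightarrow> nat \<Rightarrow> real) \<Rightarrow> nat set set \<Rightarrow> nat set set" where
  "alg_shift n \<alpha> K =
     {S. S \<subseteq> {1..n} \<and>
         ext_coset (nonface_ideal n K) (wedge_over (fvec n \<alpha>) S) \<notin>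
           ext_coset (nonface_ideal n K) `
             span {wedge_over (fvec n \<alpha>) S' | S'.
                     S' \<subseteq> {1..n} \<and> card S' = card S \<and> lex_less S' S}}"

section \<open>Sanity checks for the exterior product\<close>

lemma wedge_superset:
  assumes "finite A" "finite B" "Poly_Mapping.keys x \<subseteq> A" "Poly_Mapping.keys y \<subseteq> B"
  shows "wedge x y = (\<Sum>S\<in>A. \<Sum>T\<in>B.
        if S \<inter> T = {}
        then Poly_Mapping.single (S \<union> T)
               (ext_sign S T * Poly_Mapping.lookup x S * Poly_Mapping.lookup y T)
        else 0)"
proof -
  have "wedge x y = (\<Sum>S\<in>Poly_Mapping.keys x. \<Sum>T\<in>B.
        if S \<inter> T = {}
        then Poly_Mapping.single (S \<union> T)
               (ext_sign S T * Poly_Mapping.lookup x S * Poly_Mapping.lookup y T)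
        else 0)"
    unfolding wedge_def using assms
    by (intro sum.cong refl sum.mono_neutral_left) (auto simp: in_keys_iff)
  also have "\<dots> = (\<Sum>S\<in>A. \<Sum>T\<in>B.
        if S \<inter> T = {}
        then Poly_Mapping.single (S \<union> T)
               (ext_sign S T * Poly_Mapping.lookup x S * Poly_Mapping.lookup y T)
        else 0)"
    using assms by (intro sum.mono_neutral_left) (auto simp: in_keys_iff intro!: sum.neutral)
  finally show ?thesis .
qed

lemma wedge_single:
  "wedge (Poly_Mapping.single S a) (Poly_Mapping.single T b) =
     (if S \<inter> T = {} then Poly_Mapping.single (S \<union> T) (ext_sign S T * a * b) else 0)"
  by (subst wedge_superset[of "{S}" "{T}"]) auto

lemma wedge_add_left: "wedge (x + y) z = wedge x z + wedge y z"
proof -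
  let ?A = "Poly_Mapping.keys x \<union> Poly_Mapping.keys y" and ?B = "Poly_Mapping.keys z"
  have "Poly_Mapping.keys (x + y) \<subseteq> ?A" by (rule Poly_Mapping.keys_add)
  then show ?thesis
    by (subst (1 2 3) wedge_superset[of ?A ?B])
      (auto simp: sum.distrib[symmetric] lookup_add distrib_left distrib_right single_add
        intro!: sum.cong)
qed

lemma wedge_add_right: "wedge z (x + y) = wedge z x + wedge z y"
proof -
  let ?A = "Poly_Mapping.keys x \<union> Poly_Mapping.keys y" and ?B = "Poly_Mapping.keys z"
  have "Poly_Mapping.keys (x + y) \<subseteq> ?A" by (rule Poly_Mapping.keys_add)
  then show ?thesis
    by (subst (1 2 3) wedge_superset[of ?B ?A])
      (auto simp: sum.distrib[symmetric] lookup_add distrib_left distrib_right single_add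
        intro!: sum.cong)
qed

lemma ext_lookup_scaleR:
  "Poly_Mapping.lookup (c *\<^sub>R (x :: ext)) S = c * Poly_Mapping.lookup x S"
proof -
  have "finite {i. c * Poly_Mapping.lookup x i \<noteq> 0}"
    by (rule finite_subset[OF _ finite_keys[of x]]) (auto simp: in_keys_iff)
  then show ?thesis
    by (simp add: scaleR_poly_mapping_def Abs_poly_mapping_inverse)
qed

lemma scaleR_single: "c *\<^sub>R (Poly_Mapping.single S a :: ext) = Poly_Mapping.single S (c * a)"
  by (rule poly_mapping_eqI) (simp add: ext_lookup_scaleR lookup_single when_def)

lemma wedge_scaleR_left: "wedge (c *\<^sub>R x) y = c *\<^sub>R wedge x y"
  by (subst (1 2) wedge_superset[of "Poly_Mapping.keys x" "Poly_Mapping.keys y"])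
    (auto simp: in_keys_iff ext_lookup_scaleR scaleR_sum_right scaleR_single mult_ac intro!: sum.cong)

lemma wedge_scaleR_right: "wedge x (c *\<^sub>R y) = c *\<^sub>R wedge x y"
  by (subst (1 2) wedge_superset[of "Poly_Mapping.keys x" "Poly_Mapping.keys y"])
    (auto simp: in_keys_iff ext_lookup_scaleR scaleR_sum_right scaleR_single mult_ac intro!: sum.cong)

lemma wedge_evec_anticomm: "wedge (evec i) (evec j) = - wedge (evec j) (evec i)"
proof -
  have *: "{(s, t). s = a \<and> t = b \<and> t < s} = (if b < a then {(a, b)} else {})" for a b :: nat
    by auto
  show ?thesis
    by (auto simp: evec_def wedge_single ext_sign_def * insert_commute single_uminus)
qed

lemma wedge_over_evec:
  assumes "finite S"
  shows "wedge_over evec S = Poly_Mapping.single S 1"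
proof -
  have "foldr wedge (map evec xs) (Poly_Mapping.single {} 1) = Poly_Mapping.single (set xs) 1"
    if "sorted_wrt (<) xs" for xs
    using that
  proof (induction xs)
    case (Cons a xs)
    then have "{(s, t). s \<in> {a} \<and> t \<in> set xs \<and> t < s} = {}" by force
    then have "ext_sign {a} (set xs) = 1" unfolding ext_sign_def by (metis card.empty power_0)
    with Cons show ?case
      by (auto simp: evec_def wedge_single)
  qed simp
  from this[of "sorted_list_of_set S"] show ?thesis
    using assms by (simp add: wedge_over_def strict_sorted_list_of_set)
qed

lemma ext_sign_Un_left:
  assumes "finite S" "finite T" "finite U" "S \<inter> T = {}"
  shows "ext_sign (S \<union> T) U = ext_sign S U * ext_sign T U"
proof -
  have "{(s, t). s \<in> S \<union> T \<and> t \<in> U \<and> t < s} =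
      {(s, t). s \<in> S \<and> t \<in> U \<and> t < s} \<union> {(s, t). s \<in> T \<and> t \<in> U \<and> t < s}" by auto
  moreover have "finite {(s, t). s \<in> A \<and> t \<in> U \<and> t < s}" if "finite A" for A
    by (rule finite_subset[of _ "A \<times> U"]) (use that assms in auto)
  ultimately show ?thesis using assms
    by (simp add: ext_sign_def power_add[symmetric]) (subst card_Un_disjoint; auto)
qed

lemma ext_sign_Un_right:
  assumes "finite S" "finite T" "finite U" "T \<inter> U = {}"
  shows "ext_sign S (T \<union> U) = ext_sign S T * ext_sign S U"
proof -
  have "{(s, t). s \<in> S \<and> t \<in> T \<union> U \<and> t < s} =
      {(s, t). s \<in> S \<and> t \<in> T \<and> t < s} \<union> {(s, t). s \<in> S \<and> t \<in> U \<and> t < s}" by auto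
  moreover have "finite {(s, t). s \<in> S \<and> t \<in> A \<and> t < s}" if "finite A" for A
    by (rule finite_subset[of _ "S \<times> A"]) (use that assms in auto)
  ultimately show ?thesis using assms
    by (simp add: ext_sign_def power_add[symmetric]) (subst card_Un_disjoint; auto)
qed

lemma wedge_zero [simp]: "wedge 0 x = 0" "wedge x 0 = 0"
  by (simp_all add: wedge_def)

lemma wedge_single_assoc:
  assumes "finite S" "finite T" "finite U"
  shows "wedge (wedge (Poly_Mapping.single S a) (Poly_Mapping.single T b)) (Poly_Mapping.single U c) =
         wedge (Poly_Mapping.single S a) (wedge (Poly_Mapping.single T b) (Poly_Mapping.single U c))"
  using assms
  by (auto simp: wedge_single ext_sign_Un_left ext_sign_Un_right Int_Un_distrib Int_Un_distrib2
      Un_assoc mult_ac)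

end

theory Submission
  imports Defs
begin

text \<open>Fix a degree \<open>d\<close>, let \<open>A\<close> be the \<open>d\<close>-sets whose initial \<open>|S|\<close>-segment is lexicographically
  below a given bound, and let \<open>W\<close> be the span of the \<open>f\<^sub>T\<close> with \<open>T \<in> A\<close>.  Since \<open>A\<close> is an initial
  segment, \<open>|A \<inter> \<Delta>(K)|\<close> is the dimension of the image of \<open>W\<close> in the exterior face space of \<open>K\<close>,
  and \<open>I\<^sub>S\<^sup>i\<close> is the difference of two such \<open>A\<close>.  So it suffices that the dimensions are additive,
  and by rank-nullity this holds as soon as every element of \<open>W\<close> that vanishes on \<open>\<sigma>\<close> is a sum of
  an element of \<open>W\<close> vanishing on \<open>K\<close> and one vanishing on \<open>L\<close>.  To decompose, rewrite the last factor
  \<open>f\<^sub>r\<close> of a generator \<open>f\<^sub>T\<close> in terms of \<open>f\<^sub>1, f\<^sub>2, \<dots>\<close> (one for each vertex of \<open>\<sigma>\<close>) and the \<open>e\<^sub>j\<close> with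
  \<open>j \<notin> \<sigma>\<close>, each of which lies in at most one of \<open>K\<close> and \<open>L\<close>.  As \<open>d > |S|\<close>, changing the last factor
  does not leave \<open>W\<close>.

  The coordinates of the \<open>f\<^sub>T\<close> are polynomials in the matrix entries, so for algebraically
  independent entries all linear relations that matter are the same for every generic matrix.\<close>

section \<open>Polynomial functions at a generic point\<close>

text \<open>The functions given by polynomials with rational coefficients in the variables from
  \<open>I\<close>. Generating them by closure rules lets a determinant expansion be recognised
  without writing down a formal polynomial.\<close>

inductive polyfun :: "'i set \<Rightarrow> (('i \<Rightarrow> real) \<Rightarrow> real) \<Rightarrow> bool" for I where
  polyfun_of_rat: "polyfun I (\<lambda>a. of_rat q)"
| polyfun_var: "x \<in> I \<Longrightarrow> polyfun I (\<lambda>a. a x)"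
| polyfun_add: "polyfun I F \<Longrightarrow> polyfun I G \<Longrightarrow> polyfun I (\<lambda>a. F a + G a)"
| polyfun_mult: "polyfun I F \<Longrightarrow> polyfun I G \<Longrightarrow> polyfun I (\<lambda>a. F a * G a)"

lemma polyfun_of_int: "polyfun I (\<lambda>a. of_int k)"
  using polyfun_of_rat[of I "of_int k"] by simp

lemma polyfun_diff:
  assumes "polyfun I F" "polyfun I G"
  shows "polyfun I (\<lambda>a. F a - G a)"
  using polyfun_add[OF assms(1) polyfun_mult[OF polyfun_of_int[of I "-1"] assms(2)]] by simp

lemma polyfun_sum:
  assumes "\<And>x. x \<in> X \<Longrightarrow> polyfun I (F x)"
  shows "polyfun I (\<lambda>a. \<Sum>x\<in>X. F x a)"
  using assms
proof (induction X rule: infinite_finite_induct)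
  case (insert x X)
  then show ?case by (simp add: polyfun_add)
qed (use polyfun_of_int[of I 0] in simp_all)

section \<open>Evaluation of formal polynomials\<close>

lemma poly_eval_superset:
  assumes "finite M" "Poly_Mapping.keys p \<subseteq> M"
  shows "poly_eval a p = (\<Sum>m\<in>M. of_rat (Poly_Mapping.lookup p m) *
        (\<Prod>x\<in>Poly_Mapping.keys m. a x ^ Poly_Mapping.lookup m x))"
  unfolding poly_eval_def using assms
  by (intro sum.mono_neutral_left) (auto simp: in_keys_iff)

lemma poly_eval_single:
  "poly_eval a (Poly_Mapping.single m c) =
     of_rat c * (\<Prod>x\<in>Poly_Mapping.keys m. a x ^ Poly_Mapping.lookup m x)"
  by (subst poly_eval_superset[of "{m}"]) auto

lemma poly_eval_0: "poly_eval a 0 = 0"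
  by (simp add: poly_eval_def)

lemma poly_eval_add: "poly_eval a (p + q) = poly_eval a p + poly_eval a q"
  by (subst (1 2 3) poly_eval_superset[of "Poly_Mapping.keys p \<union> Poly_Mapping.keys q"])
    (use Poly_Mapping.keys_add[of p q] in
      \<open>auto simp: lookup_add of_rat_add distrib_right sum.distrib\<close>)

lemma monomial_eval_add:
  fixes m m' :: "'i \<Rightarrow>\<^sub>0 nat" and a :: "'i \<Rightarrow> real"
  shows "(\<Prod>x\<in>Poly_Mapping.keys (m + m'). a x ^ Poly_Mapping.lookup (m + m') x) =
     (\<Prod>x\<in>Poly_Mapping.keys m. a x ^ Poly_Mapping.lookup m x) *
     (\<Prod>x\<in>Poly_Mapping.keys m'. a x ^ Poly_Mapping.lookup m' x)"
proof -
  let ?X = "Poly_Mapping.keys m \<union> Poly_Mapping.keys m'"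
  have *: "(\<Prod>x\<in>Poly_Mapping.keys k. a x ^ Poly_Mapping.lookup k x) =
      (\<Prod>x\<in>?X. a x ^ Poly_Mapping.lookup k x)" if "Poly_Mapping.keys k \<subseteq> ?X" for k
    using that by (intro prod.mono_neutral_left) (auto simp: in_keys_iff)
  show ?thesis
    by (simp only: *[OF Poly_Mapping.keys_add] *[OF Un_upper1] *[OF Un_upper2])
      (simp add: lookup_add power_add prod.distrib)
qed

lemma poly_mapping_eq_sum_single:
  "p = (\<Sum>k\<in>Poly_Mapping.keys p. Poly_Mapping.single k (Poly_Mapping.lookup p k))"
  by (rule poly_mapping_eqI) (auto simp: lookup_sum lookup_single when_def in_keys_iff)

lemma poly_eval_sum: "poly_eval a (\<Sum>x\<in>X. f x) = (\<Sum>x\<in>X. poly_eval a (f x))"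
  by (induction X rule: infinite_finite_induct) (simp_all add: poly_eval_0 poly_eval_add)

lemma poly_eval_mult: "poly_eval a (p * q) = poly_eval a p * poly_eval a q"
proof -
  let ?s = "\<lambda>p k. Poly_Mapping.single k (Poly_Mapping.lookup p k)"
  have "p * q = (\<Sum>k\<in>Poly_Mapping.keys p. ?s p k) * (\<Sum>l\<in>Poly_Mapping.keys q. ?s q l)"
    by (simp flip: poly_mapping_eq_sum_single)
  also have "poly_eval a \<dots> = poly_eval a (\<Sum>k\<in>Poly_Mapping.keys p. ?s p k) *
      poly_eval a (\<Sum>l\<in>Poly_Mapping.keys q. ?s q l)"
    by (simp add: sum_product poly_eval_sum Poly_Mapping.mult_single poly_eval_single of_rat_mult
        monomial_eval_add mult_ac)
  finally show ?thesis
    by (simp flip: poly_mapping_eq_sum_single)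
qed

text \<open>Links the closure rules to the formal polynomials in which
  \<open>alg_independent\<close> is phrased. The variables of a sum or a product come from its two
  arguments, so they stay in \<open>I\<close>.\<close>

lemma polyfun_imp_poly_eval:
  assumes "polyfun I F"
  shows "\<exists>p. (\<forall>m\<in>Poly_Mapping.keys p. Poly_Mapping.keys m \<subseteq> I) \<and> F = (\<lambda>a. poly_eval a p)"
  using assms
proof induction
  case (polyfun_of_rat q)
  show ?case
    by (rule exI[of _ "Poly_Mapping.single 0 q"]) (simp add: poly_eval_single)
next
  case (polyfun_var x)
  then show ?case
    by (intro exI[of _ "Poly_Mapping.single (Poly_Mapping.single x 1) 1"])
      (simp add: poly_eval_single)
next
  case (polyfun_add F G)
  then obtain p q where
    "\<forall>m\<in>Poly_Mapping.keys p. Poly_Mapping.keys m \<subseteq> I" "F = (\<lambda>a. poly_eval a p)"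
    "\<forall>m\<in>Poly_Mapping.keys q. Poly_Mapping.keys m \<subseteq> I" "G = (\<lambda>a. poly_eval a q)" by blast
  then show ?case
    using Poly_Mapping.keys_add[of p q]
    by (intro exI[of _ "p + q"]) (auto simp: poly_eval_add subset_iff)
next
  case (polyfun_mult F G)
  then obtain p q where p:
    "\<forall>m\<in>Poly_Mapping.keys p. Poly_Mapping.keys m \<subseteq> I" "F = (\<lambda>a. poly_eval a p)"
    and q: "\<forall>m\<in>Poly_Mapping.keys q. Poly_Mapping.keys m \<subseteq> I" "G = (\<lambda>a. poly_eval a q)" by blast
  have "Poly_Mapping.keys m \<subseteq> I" if "m \<in> Poly_Mapping.keys (p * q)" for m
  proof -
    from that obtain k l where "k \<in> Poly_Mapping.keys p" "l \<in> Poly_Mapping.keys q" "m = k + l"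
      using Poly_Mapping.keys_mult[of p q] by blast
    then show ?thesis using p(1) q(1) Poly_Mapping.keys_add[of k l] by blast
  qed
  then show ?case
    using p q by (intro exI[of _ "p * q"]) (auto simp: poly_eval_mult)
qed

text \<open>A zero at an algebraically independent point forces the formal polynomial itself to be
  0. The point \<open>b\<close> is arbitrary, so by contraposition one nonzero value anywhere gives
  a nonzero value at every generic point.\<close>

lemma polyfun_eq_0_if_generic:
  assumes "polyfun I F" "alg_independent I a" "F a = 0"
  shows "F b = 0"
proof -
  obtain p where p: "\<forall>m\<in>Poly_Mapping.keys p. Poly_Mapping.keys m \<subseteq> I" "F = (\<lambda>a. poly_eval a p)"
    using polyfun_imp_poly_eval[OF assms(1)] by blast
  then have "p = 0" using assms(2,3) unfolding alg_independent_def by blast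
  with p(2) show ?thesis by (simp add: poly_eval_0)
qed

lemma alg_independent_subset: "alg_independent I a \<Longrightarrow> J \<subseteq> I \<Longrightarrow> alg_independent J a"
  unfolding alg_independent_def by (meson subset_trans)

text \<open>Both transfer lemmas are fraction-free Gaussian elimination: the pivot, being a polynomial
  in the parameters, vanishes at a generic point only if it vanishes identically.\<close>

lemma generic_combination_transfer:
  fixes v :: "'t \<Rightarrow> 'q \<Rightarrow> ('i \<Rightarrow> real) \<Rightarrow> real"
  assumes "finite A" "\<And>t q. t \<in> A \<Longrightarrow> q \<in> E \<Longrightarrow> polyfun I (v t q)"
    and "\<And>q. q \<in> E \<Longrightarrow> polyfun I (w q)"
    and a: "alg_independent I a" and b: "alg_independent I b"
    and "\<exists>c. \<forall>q\<in>E. w q a = (\<Sum>t\<in>A. c t * v t q a)"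
  shows "\<exists>c. \<forall>q\<in>E. w q b = (\<Sum>t\<in>A. c t * v t q b)"
  using assms(1,2,3,6)
proof (induction A arbitrary: v w rule: finite_induct)
  case empty
  then have *: "w q a = 0" if "q \<in> E" for q using that by simp
  have "w q b = 0" if "q \<in> E" for q
    by (rule polyfun_eq_0_if_generic[OF empty(2)[OF that] a *[OF that]])
  then show ?case by simp
next
  case (insert x A)
  obtain c where "\<forall>q\<in>E. w q a = (\<Sum>t\<in>insert x A. c t * v t q a)"
    using insert.prems(3) by blast
  then have c: "\<forall>q\<in>E. w q a = c x * v x q a + (\<Sum>t\<in>A. c t * v t q a)"
    using insert.hyps by simp
  show ?case
  proof (cases "\<forall>q\<in>E. v x q a = 0")
    case True
    then have vx: "\<forall>q\<in>E. v x q b = 0"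
      using polyfun_eq_0_if_generic[OF _ a] insert.prems(1) by blast
    have "\<exists>c. \<forall>q\<in>E. w q b = (\<Sum>t\<in>A. c t * v t q b)"
    proof (rule insert.IH)
      have "\<forall>q\<in>E. w q a = (\<Sum>t\<in>A. c t * v t q a)"
        using c True by simp
      then show "\<exists>c. \<forall>q\<in>E. w q a = (\<Sum>t\<in>A. c t * v t q a)" by blast
    qed (use insert.prems(1,2) in auto)
    then obtain d where "\<forall>q\<in>E. w q b = (\<Sum>t\<in>A. d t * v t q b)" by blast
    then have "\<forall>q\<in>E. w q b = (\<Sum>t\<in>insert x A. d t * v t q b)"
      using vx insert.hyps by simp
    then show ?thesis by blast
  next
    case False
    then obtain q0 where q0: "q0 \<in> E" "v x q0 a \<noteq> 0" by blast
    \<comment> \<open>The same coordinate is a pivot at \<open>b\<close>, since a zero at the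
      generic point \<open>b\<close> would be a zero at \<open>a\<close> as well.\<close>
    then have nz: "v x q0 b \<noteq> 0"
      using polyfun_eq_0_if_generic[OF _ b] insert.prems(1) by blast
    \<comment> \<open>Two-by-two minors against the pivot: the contribution of \<open>x\<close>
      cancels, and as there is no division the entries remain polynomial, so the induction
      hypothesis applies to them.\<close>
    define v' where "v' t q = (\<lambda>y. v x q0 y * v t q y - v t q0 y * v x q y)" for t q
    define w' where "w' q = (\<lambda>y. v x q0 y * w q y - w q0 y * v x q y)" for q
    have "\<exists>c. \<forall>q\<in>E. w' q b = (\<Sum>t\<in>A. c t * v' t q b)"
    proof (rule insert.IH)
      have "w' q a = (\<Sum>t\<in>A. c t * v' t q a)" if "q \<in> E" for q
      proof -
        have "w' q a = v x q0 a * (\<Sum>t\<in>A. c t * v t q a) - (\<Sum>t\<in>A. c t * v t q0 a) * v x q a"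
          using bspec[OF c that] bspec[OF c q0(1)] by (simp only: w'_def) (simp add: algebra_simps)
        also have "\<dots> = (\<Sum>t\<in>A. c t * v' t q a)"
          by (simp add: v'_def sum_distrib_left sum_distrib_right sum_subtractf[symmetric]
              algebra_simps)
        finally show ?thesis .
      qed
      then show "\<exists>c. \<forall>q\<in>E. w' q a = (\<Sum>t\<in>A. c t * v' t q a)" by blast
    qed (use insert.prems(1,2) q0 in \<open>auto simp: v'_def w'_def intro!: polyfun_diff polyfun_mult\<close>)
    then obtain d where d: "\<forall>q\<in>E. w' q b = (\<Sum>t\<in>A. d t * v' t q b)" by blast
    define D where "D = (\<Sum>t\<in>A. d t * v t q0 b)"
    \<comment> \<open>Back-substitution at \<open>b\<close>. The coefficient of \<open>x\<close> is
      the one that makes the equation right in coordinate \<open>q0\<close>; \<open>D\<close> is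
      what the other columns contribute there.\<close>
    have solve: "w q b = (w q0 b - D) / v x q0 b * v x q b + (\<Sum>t\<in>A. d t * v t q b)"
      if "q \<in> E" for q
    proof -
      have "(\<Sum>t\<in>A. d t * v' t q b) = v x q0 b * (\<Sum>t\<in>A. d t * v t q b) - D * v x q b"
        by (simp add: D_def v'_def sum_distrib_left sum_distrib_right sum_subtractf[symmetric]
            algebra_simps)
      then have "v x q0 b * w q b = (w q0 b - D) * v x q b + v x q0 b * (\<Sum>t\<in>A. d t * v t q b)"
        using bspec[OF d that] by (simp add: w'_def left_diff_distrib)
      then have "w q b = ((w q0 b - D) * v x q b + v x q0 b * (\<Sum>t\<in>A. d t * v t q b)) / v x q0 b"
        using nz by (metis nonzero_mult_div_cancel_left)
      then show ?thesis using nz by (simp only: add_divide_distrib) simp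
    qed
    have upd: "e * v x q b + (\<Sum>t\<in>A. d t * v t q b) =
        (\<Sum>t\<in>insert x A. (d(x := e)) t * v t q b)" for e q
      using insert.hyps by (auto intro!: sum.cong)
    have "w q b = (\<Sum>t\<in>insert x A. (d(x := (w q0 b - D) / v x q0 b)) t * v t q b)"
      if "q \<in> E" for q
      by (rule trans[OF solve[OF that] upd])
    then show ?thesis by blast
  qed
qed

lemma generic_independence_transfer:
  fixes v :: "'t \<Rightarrow> 'q \<Rightarrow> ('i \<Rightarrow> real) \<Rightarrow> real"
  assumes "finite A" "\<And>t q. t \<in> A \<Longrightarrow> q \<in> E \<Longrightarrow> polyfun I (v t q)"
    and a: "alg_independent I a"
    and "\<And>c. \<forall>q\<in>E. (\<Sum>t\<in>A. c t * v t q b) = 0 \<Longrightarrow> \<forall>t\<in>A. c t = 0"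
    and "\<forall>q\<in>E. (\<Sum>t\<in>A. c t * v t q a) = 0"
  shows "\<forall>t\<in>A. c t = 0"
  using assms(1,2,4,5)
proof (induction A arbitrary: v c rule: finite_induct)
  case (insert x A)
  \<comment> \<open>Otherwise the coefficients 1 at \<open>x\<close> and 0 elsewhere would be a
    nontrivial relation at \<open>b\<close>.\<close>
  have "\<not> (\<forall>q\<in>E. v x q b = 0)"
  proof
    assume *: "\<forall>q\<in>E. v x q b = 0"
    have "\<forall>t\<in>insert x A. (if t = x then 1 else 0 :: real) = 0"
    proof (rule insert.prems(2), rule ballI)
      fix q assume "q \<in> E"
      with * show "(\<Sum>t\<in>insert x A. (if t = x then 1 else 0) * v t q b) = 0"
        by (intro sum.neutral) auto
    qed
    then show False by simp
  qed
  then obtain q0 where q0: "q0 \<in> E" "v x q0 b \<noteq> 0" by blast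
  \<comment> \<open>The pivot is chosen at \<open>b\<close>, which may be a special point, and
    carried over to the generic point \<open>a\<close>.\<close>
  then have nz: "v x q0 a \<noteq> 0"
    using polyfun_eq_0_if_generic[OF _ a] insert.prems(1) by blast
  define v' where "v' t q = (\<lambda>y. v x q0 y * v t q y - v t q0 y * v x q y)" for t q
  have v': "(\<Sum>t\<in>A. d t * v' t q y) =
      v x q0 y * (\<Sum>t\<in>A. d t * v t q y) - (\<Sum>t\<in>A. d t * v t q0 y) * v x q y" for d q y
    by (simp add: v'_def sum_distrib_left sum_distrib_right sum_subtractf[symmetric]
        algebra_simps)
  have c0: "\<forall>t\<in>A. c t = 0"
  proof (rule insert.IH)
    fix d assume d: "\<forall>q\<in>E. (\<Sum>t\<in>A. d t * v' t q b) = 0"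
    \<comment> \<open>Lifts a relation among the eliminated columns to one among the original
      columns; the coefficient of \<open>x\<close> collects the correction terms.\<close>
    define e where
      "e t = (if t = x then - (\<Sum>t\<in>A. d t * v t q0 b) else v x q0 b * d t)" for t
    have "\<forall>t\<in>insert x A. e t = 0"
    proof (rule insert.prems(2), rule ballI)
      fix q assume q: "q \<in> E"
      have "(\<Sum>t\<in>A. e t * v t q b) = v x q0 b * (\<Sum>t\<in>A. d t * v t q b)"
        unfolding sum_distrib_left using insert.hyps by (intro sum.cong) (auto simp: e_def)
      then show "(\<Sum>t\<in>insert x A. e t * v t q b) = 0"
        using d q insert.hyps by (simp add: v') (simp add: e_def)
    qed
    then show "\<forall>t\<in>A. d t = 0"
      using q0 insert.hyps by (auto simp: e_def split: if_splits)
  next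
    show "\<forall>q\<in>E. (\<Sum>t\<in>A. c t * v' t q a) = 0"
    proof
      fix q assume "q \<in> E"
      then have "(\<Sum>t\<in>A. c t * v t q a) = - c x * v x q a"
        "(\<Sum>t\<in>A. c t * v t q0 a) = - c x * v x q0 a"
        using insert.prems(3) insert.hyps q0 by (auto simp: add_eq_0_iff2)
      then show "(\<Sum>t\<in>A. c t * v' t q a) = 0" by (simp add: v')
    qed
  qed (use insert.prems q0 in \<open>auto simp: v'_def intro!: polyfun_diff polyfun_mult\<close>)
  moreover have "c x * v x q0 a = 0"
    using bspec[OF insert.prems(3) q0(1)] insert.hyps c0 by simp
  ultimately show ?case using nz by simp
qed simp

section \<open>Exterior products of vectors\<close>

lemma linear_wedge_right: "linear (wedge x)"
  by (intro linearI wedge_add_right wedge_scaleR_right)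

lemma linear_wedge_left: "linear (\<lambda>x. wedge x y)"
  by (intro linearI wedge_add_left wedge_scaleR_left)

text \<open>A pair of index sets contributes to the coordinate at \<open>W\<close> only if it splits
  \<open>W\<close>, so the second set is the complement of the first.\<close>

lemma lookup_wedge:
  assumes "finite W"
  shows "Poly_Mapping.lookup (wedge x y) W =
    (\<Sum>S\<in>Pow W. ext_sign S (W - S) * Poly_Mapping.lookup x S * Poly_Mapping.lookup y (W - S))"
proof -
  let ?A = "Poly_Mapping.keys x \<union> Pow W" and ?B = "Poly_Mapping.keys y \<union> Pow W"
  let ?t = "\<lambda>S T. ext_sign S T * Poly_Mapping.lookup x S * Poly_Mapping.lookup y T"
  have fin: "finite ?A" "finite ?B" using assms by auto
  have "wedge x y = (\<Sum>S\<in>?A. \<Sum>T\<in>?B. if S \<inter> T = {} then Poly_Mapping.single (S \<union> T) (?t S T) else 0)"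
    by (rule wedge_superset) (use fin in auto)
  then have "Poly_Mapping.lookup (wedge x y) W =
      (\<Sum>S\<in>?A. \<Sum>T\<in>?B. if S \<inter> T = {} \<and> S \<union> T = W then ?t S T else 0)"
    by (simp add: lookup_sum if_distrib[of "\<lambda>u. Poly_Mapping.lookup u W"] lookup_single when_def
        if_if_eq_conj cong: if_cong)
  also have "\<dots> = (\<Sum>S\<in>?A. if S \<subseteq> W then ?t S (W - S) else 0)"
  proof (rule sum.cong[OF refl])
    fix S
    have "(\<Sum>T\<in>?B. if S \<inter> T = {} \<and> S \<union> T = W then ?t S T else 0) =
        (\<Sum>T\<in>?B. if T = W - S then (if S \<subseteq> W then ?t S (W - S) else 0) else 0)"
      by (rule sum.cong) auto
    then show "(\<Sum>T\<in>?B. if S \<inter> T = {} \<and> S \<union> T = W then ?t S T else 0) =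
        (if S \<subseteq> W then ?t S (W - S) else 0)"
      using fin by (simp add: sum.delta')
  qed
  also have "\<dots> = (\<Sum>S\<in>Pow W. ?t S (W - S))"
    using fin by (intro sum.mono_neutral_cong_right) auto
  finally show ?thesis .
qed

lemma keys_wedge:
  assumes "W \<in> Poly_Mapping.keys (wedge x y)"
  obtains S T where "W = S \<union> T" "S \<in> Poly_Mapping.keys x" "T \<in> Poly_Mapping.keys y"
proof -
  define t where "t S T = (if S \<inter> T = {} then Poly_Mapping.single (S \<union> T)
      (ext_sign S T * Poly_Mapping.lookup x S * Poly_Mapping.lookup y T) else 0)" for S T
  have "W \<in> Poly_Mapping.keys (\<Sum>S\<in>Poly_Mapping.keys x. \<Sum>T\<in>Poly_Mapping.keys y. t S T)"
    using assms by (simp add: wedge_def t_def)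
  then have "W \<in> (\<Union>S\<in>Poly_Mapping.keys x. Poly_Mapping.keys (\<Sum>T\<in>Poly_Mapping.keys y. t S T))"
    by (rule subsetD[OF Poly_Mapping.keys_sum])
  then obtain S where S: "S \<in> Poly_Mapping.keys x"
    and "W \<in> Poly_Mapping.keys (\<Sum>T\<in>Poly_Mapping.keys y. t S T)" by blast
  from subsetD[OF Poly_Mapping.keys_sum this(2)] obtain T where
    T: "T \<in> Poly_Mapping.keys y" "W \<in> Poly_Mapping.keys (t S T)" by blast
  then have "W = S \<union> T" by (simp add: t_def split: if_splits)
  from that[OF this S T(1)] show thesis .
qed

section \<open>Vectors and anticommutation\<close>

lemma keys_scaleR_subset: "Poly_Mapping.keys (c *\<^sub>R (x :: ext)) \<subseteq> Poly_Mapping.keys x"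
  by (auto simp: in_keys_iff ext_lookup_scaleR)

lemma subspace_keys_subset: "subspace {x :: ext. Poly_Mapping.keys x \<subseteq> A}"
proof (rule subspaceI)
  show "x + y \<in> {x. Poly_Mapping.keys x \<subseteq> A}"
    if "x \<in> {x. Poly_Mapping.keys x \<subseteq> A}" "y \<in> {x. Poly_Mapping.keys x \<subseteq> A}" for x y :: ext
    using that Poly_Mapping.keys_add[of x y] by blast
  show "c *\<^sub>R x \<in> {x. Poly_Mapping.keys x \<subseteq> A}"
    if "x \<in> {x. Poly_Mapping.keys x \<subseteq> A}" for c and x :: ext
    using that keys_scaleR_subset[of c x] by blast
qed simp

lemma keys_span_evec:
  assumes "x \<in> span (evec ` J)"
  shows "Poly_Mapping.keys x \<subseteq> (\<lambda>j. {j}) ` J"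
proof -
  have "span (evec ` J) \<subseteq> {x. Poly_Mapping.keys x \<subseteq> (\<lambda>j. {j}) ` J}"
    by (intro span_minimal subspace_keys_subset) (auto simp: evec_def)
  with assms show ?thesis by blast
qed

lemma wedge_swap_single:
  assumes "finite S"
  shows "wedge (evec i) (wedge (evec j) (Poly_Mapping.single S c)) =
    - wedge (evec j) (wedge (evec i) (Poly_Mapping.single S c))"
  using assms wedge_evec_anticomm[of i j] linear_neg[OF linear_wedge_left]
  by (simp add: evec_def wedge_single_assoc[symmetric])

text \<open>Both sides are linear in \<open>x\<close> and in \<open>y\<close>, which reduces the
  claim to basis vectors. There it is \<open>wedge_evec_anticomm\<close> after regrouping, and the
  finiteness of the index sets is what \<open>wedge_single_assoc\<close> asks for.\<close>

lemma wedge_swap: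
  assumes x: "x \<in> span (range evec)" and y: "y \<in> span (range evec)"
    and z: "\<forall>S\<in>Poly_Mapping.keys z. finite S"
  shows "wedge x (wedge y z) = - wedge y (wedge x z)"
proof -
  have lin: "linear (\<lambda>x. wedge x (wedge y z))" "linear (\<lambda>x. - wedge y (wedge x z))" for y
    by (simp_all add: linear_iff wedge_add_left wedge_add_right wedge_scaleR_left wedge_scaleR_right)
  have base: "wedge (evec i) (wedge (evec j) z) = - wedge (evec j) (wedge (evec i) z)" for i j
  proof -
    have "wedge (evec i) (wedge (evec j) z) = (\<Sum>S\<in>Poly_Mapping.keys z.
        wedge (evec i) (wedge (evec j) (Poly_Mapping.single S (Poly_Mapping.lookup z S))))" for i j
      by (subst poly_mapping_eq_sum_single[of z])
        (simp only: linear_sum[OF linear_wedge_right])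
    then show ?thesis
      using z by (simp add: wedge_swap_single[of _ i j] sum_negf)
  qed
  have half: "wedge x (wedge (evec j) z) = - wedge (evec j) (wedge x z)" for j
    by (rule linear_eq_on_span[OF lin _ x]) (erule rangeE, hypsubst, rule base)
  have "wedge y (wedge x z) = - wedge x (wedge y z)"
  proof (rule linear_eq_on_span[OF lin _ y])
    fix e assume "e \<in> range evec"
    then obtain j where "e = evec j" by blast
    then show "wedge e (wedge x z) = - wedge x (wedge e z)" using half[of j] by simp
  qed
  then show ?thesis by simp
qed

lemma wedge_self:
  assumes "x \<in> span (range evec)" "\<forall>S\<in>Poly_Mapping.keys z. finite S"
  shows "wedge x (wedge x z) = 0"
proof (rule poly_mapping_eqI)
  fix S
  have "Poly_Mapping.lookup (wedge x (wedge x z)) S = Poly_Mapping.lookup (- wedge x (wedge x z)) S"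
    by (rule arg_cong[OF wedge_swap[OF assms(1,1,2)]])
  then show "Poly_Mapping.lookup (wedge x (wedge x z)) S = Poly_Mapping.lookup 0 S" by (simp add: lookup_uminus)
qed

text \<open>The fold of \<open>wedge_over\<close> for an arbitrary list, so that unsorted or
  repeated factors, as they arise from a substitution, can be expressed.\<close>

definition wedges :: "ext list \<Rightarrow> ext" where
  "wedges xs = foldr wedge xs (Poly_Mapping.single {} 1)"

lemma wedges_simps [simp]:
  "wedges [] = Poly_Mapping.single {} 1" "wedges (x # xs) = wedge x (wedges xs)"
  by (simp_all add: wedges_def)

lemma wedge_over_eq_wedges: "wedge_over v S = wedges (map v (sorted_list_of_set S))"
  by (simp add: wedge_over_def wedges_def)

lemma keys_wedges:
  assumes "\<And>x. x \<in> set xs \<Longrightarrow> x \<in> span (evec ` J)" "W \<in> Poly_Mapping.keys (wedges xs)"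
  shows "finite W \<and> W \<subseteq> J"
  using assms
proof (induction xs arbitrary: W)
  case (Cons x xs)
  from Cons.prems(2) obtain S T where
    "W = S \<union> T" "S \<in> Poly_Mapping.keys x" "T \<in> Poly_Mapping.keys (wedges xs)"
    unfolding wedges_simps by (rule keys_wedge)
  moreover have "finite T \<and> T \<subseteq> J"
    by (rule Cons.IH) (use Cons.prems(1) calculation in auto)
  moreover have "S \<in> (\<lambda>j. {j}) ` J"
    using keys_span_evec[of x J] Cons.prems(1)[of x] calculation by auto
  ultimately show ?case by auto
qed simp

text \<open>Each index set of a product contains an index from every factor. With \<open>J\<close> a
  singleton this makes a product with factor \<open>evec j\<close> vanish on all faces that avoid
  \<open>j\<close>.\<close>

lemma keys_wedges_meet:
  assumes "x \<in> set xs" "x \<in> span (evec ` J)" "W \<in> Poly_Mapping.keys (wedges xs)"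
  shows "W \<inter> J \<noteq> {}"
  using assms(1,3)
proof (induction xs arbitrary: W)
  case (Cons y xs)
  from Cons.prems(2) obtain S T where
    "W = S \<union> T" "S \<in> Poly_Mapping.keys y" "T \<in> Poly_Mapping.keys (wedges xs)"
    unfolding wedges_simps by (rule keys_wedge)
  moreover have "S \<in> (\<lambda>j. {j}) ` J" if "x = y"
    using keys_span_evec[OF assms(2)] calculation that by blast
  moreover have "T \<inter> J \<noteq> {}" if "x \<noteq> y"
    by (rule Cons.IH) (use Cons.prems(1) calculation that in auto)
  ultimately show ?case by (cases "x = y") auto
qed simp

text \<open>One insertion step of sorting: \<open>v u\<close> moves past the smaller factors, each
  swap changes the sign, and meeting a second copy of itself gives 0. Only this vanishing of the
  scalar is recorded, not its sign.\<close>

lemma wedge_wedges_sorted: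
  fixes v :: "nat \<Rightarrow> ext"
  assumes v: "\<And>i. v i \<in> span (range evec)" and "sorted_wrt (<) xs"
  shows "\<exists>c. wedge (v u) (wedges (map v xs)) = c *\<^sub>R wedge_over v (insert u (set xs)) \<and>
    (u \<in> set xs \<longrightarrow> c = 0)"
  using assms(2)
proof (induction xs)
  case Nil
  show ?case by (intro exI[of _ 1]) (simp add: wedge_over_eq_wedges)
next
  case (Cons x xs)
  have fin: "\<forall>S\<in>Poly_Mapping.keys (wedges (map v xs)). finite S"
    using keys_wedges[of "map v xs" UNIV] v by auto
  have sorted: "sorted_list_of_set (set ys) = ys" if "sorted_wrt (<) ys" for ys :: "nat list"
    using that by (simp add: sorted_list_of_set.idem_if_sorted_distinct strict_sorted_iff)
  consider "u < x" | "u = x" | "x < u" by linarith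
  then show ?case
  proof cases
    case 1
    then have "sorted_wrt (<) (u # x # xs)" using Cons.prems by fastforce
    then have "wedge_over v (insert u (set (x # xs))) = wedges (map v (u # x # xs))"
      unfolding wedge_over_eq_wedges list.set(2)[symmetric] by (simp only: sorted)
    then show ?thesis
      using 1 Cons.prems by (intro exI[of _ 1]) auto
  next
    case 2
    then show ?thesis
      using wedge_self[OF v fin] by (intro exI[of _ 0]) simp
  next
    case 3
    obtain c where c: "wedge (v u) (wedges (map v xs)) = c *\<^sub>R wedge_over v (insert u (set xs))"
      "u \<in> set xs \<longrightarrow> c = 0" using Cons by auto
    have "sorted_list_of_set (insert u (set (x # xs))) = x # sorted_list_of_set (insert u (set xs))"
    proof -
      define Y where "Y = insert u (set xs)"
      have "finite Y" "\<forall>y\<in>Y. x < y" "insert u (set (x # xs)) = insert x Y"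
        using Cons.prems 3 by (auto simp: Y_def)
      moreover from this have "sorted_wrt (<) (x # sorted_list_of_set Y)"
        by (simp add: strict_sorted_list_of_set)
      ultimately show ?thesis
        unfolding Y_def[symmetric] using sorted[of "x # sorted_list_of_set Y"] by simp
    qed
    then have "wedge (v x) (wedge_over v (insert u (set xs))) = wedge_over v (insert u (set (x # xs)))"
      by (simp add: wedge_over_eq_wedges)
    moreover have "wedge (v u) (wedges (map v (x # xs))) = - wedge (v x) (wedge (v u) (wedges (map v xs)))"
      unfolding list.map wedges_simps by (rule wedge_swap[OF v v fin])
    ultimately have "wedge (v u) (wedges (map v (x # xs))) =
        (- c) *\<^sub>R wedge_over v (insert u (set (x # xs)))"
      by (simp only: c(1) wedge_scaleR_right scaleR_minus_left)
    moreover have "u \<in> set (x # xs) \<longrightarrow> - c = 0"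
      using c(2) 3 by simp
    ultimately show ?thesis by blast
  qed
qed

lemma wedges_eq_scaleR_wedge_over:
  assumes v: "\<And>i. v i \<in> span (range evec)"
  shows "\<exists>c. wedges (map v us) = c *\<^sub>R wedge_over v (set us) \<and> (\<not> distinct us \<longrightarrow> c = 0)"
proof (induction us)
  case Nil
  show ?case by (intro exI[of _ 1]) (simp add: wedge_over_eq_wedges)
next
  case (Cons u us)
  then obtain c where c: "wedges (map v us) = c *\<^sub>R wedge_over v (set us)" "\<not> distinct us \<longrightarrow> c = 0"
    by blast
  obtain d where "wedge (v u) (wedge_over v (set us)) = d *\<^sub>R wedge_over v (insert u (set us))"
    "u \<in> set us \<longrightarrow> d = 0"
    using wedge_wedges_sorted[of v "sorted_list_of_set (set us)" u] v
    by (auto simp: wedge_over_eq_wedges strict_sorted_list_of_set)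
  with c show ?case
    by (intro exI[of _ "c * d"]) (auto simp: wedge_scaleR_right)
qed

text \<open>The product is that of the list with \<open>u\<close> in the place of \<open>r\<close>;
  sorting this list costs a scalar, which is 0 if \<open>u\<close> already occurs. This is the
  exchange step of the straightening below.\<close>

lemma wedge_over_replace:
  assumes v: "\<And>i. v i \<in> span (range evec)" and T: "finite T" "r \<in> T"
  shows "\<exists>c. wedge_over (v(r := v u)) T = c *\<^sub>R wedge_over v (insert u (T - {r})) \<and>
    (u \<in> T - {r} \<longrightarrow> c = 0)"
proof -
  let ?us = "map (\<lambda>i. if i = r then u else i) (sorted_list_of_set T)"
  have "set ?us = insert u (T - {r})" using T by auto
  moreover have "wedge_over (v(r := v u)) T = wedges (map v ?us)"
    unfolding wedge_over_eq_wedges by (rule arg_cong[of _ _ wedges]) auto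
  moreover have "\<not> distinct ?us" if "u \<in> T - {r}"
    using that T by (auto simp: distinct_map inj_on_def)
  ultimately show ?thesis
    using wedges_eq_scaleR_wedge_over[of v ?us] v by auto
qed

text \<open>Distinctness ensures that the varied factor enters at exactly one place.\<close>

lemma linear_wedges_update:
  assumes "distinct us" "r \<in> set us"
  shows "linear (\<lambda>x. wedges (map (v(r := x)) us))"
  using assms
proof (induction us)
  case (Cons u us)
  show ?case
  proof (cases "u = r")
    case True
    then have eq: "map (v(r := x)) us = map v us" for x using Cons.prems by auto
    have "wedges (map (v(r := x)) (u # us)) = wedge x (wedges (map v us))" for x
      by (simp only: list.map True eq fun_upd_same wedges_simps)
    then show ?thesis using linear_wedge_left by presburger
  next
    case False
    then have lin: "linear (\<lambda>x. wedges (map (v(r := x)) us))"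
      by (intro Cons.IH) (use Cons.prems in auto)
    have "wedges (map (v(r := x)) (u # us)) = wedge (v u) (wedges (map (v(r := x)) us))" for x
      by (simp only: list.map wedges_simps fun_upd_other[OF False])
    with linear_compose[OF lin linear_wedge_right] show ?thesis
      by (simp only: o_def)
  qed
qed simp

lemma linear_wedge_over_update:
  assumes "finite T" "r \<in> T"
  shows "linear (\<lambda>x. wedge_over (v(r := x)) T)"
  unfolding wedge_over_eq_wedges using assms by (intro linear_wedges_update) auto

lemma keys_wedge_over:
  assumes "finite T" "\<And>i. i \<in> T \<Longrightarrow> v i \<in> span (evec ` J)" "W \<in> Poly_Mapping.keys (wedge_over v T)"
  shows "finite W" "W \<subseteq> J"
  using keys_wedges[of "map v (sorted_list_of_set T)" J W] assms by (auto simp: wedge_over_eq_wedges)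

lemma keys_wedge_over_meet:
  assumes "finite T" "r \<in> T" "v r \<in> span (evec ` J)" "W \<in> Poly_Mapping.keys (wedge_over v T)"
  shows "W \<inter> J \<noteq> {}"
  using keys_wedges_meet[of "v r" "map v (sorted_list_of_set T)" J W] assms
  by (auto simp: wedge_over_eq_wedges)

text \<open>Laplace expansion along the first row: the minor of \<open>a\<close> with rows
  \<open>ts\<close> and columns \<open>W\<close>, where \<open>ext_sign\<close> is the cofactor
  sign. If the numbers of rows and columns differ, the value is 0.\<close>

fun minor :: "(nat \<times> nat \<Rightarrow> real) \<Rightarrow> nat list \<Rightarrow> nat set \<Rightarrow> real" where
  "minor a [] W = (if W = {} then 1 else 0)"
| "minor a (t # ts) W = (\<Sum>j\<in>W. ext_sign {j} (W - {j}) * a (t, j) * minor a ts (W - {j}))"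

lemma polyfun_minor: "set ts \<times> W \<subseteq> I \<Longrightarrow> polyfun I (\<lambda>a. minor a ts W)"
proof (induction ts arbitrary: W)
  case Nil
  show ?case using polyfun_of_int[of I 1] polyfun_of_int[of I 0] by simp
next
  case (Cons t ts)
  have *: "polyfun I (\<lambda>a. ext_sign {j} (W - {j}))" for j
    using polyfun_of_int[of I "(-1) ^ card {(s, t). s \<in> {j} \<and> t \<in> W - {j} \<and> t < s}"]
    by (simp add: ext_sign_def)
  show ?case
    using Cons.prems
    by (auto intro!: polyfun_sum polyfun_mult * polyfun_var Cons.IH)
qed

lemma fvec_in_span: "fvec N \<alpha> i \<in> span (evec ` {1..N})"
  unfolding fvec_def by (intro span_sum span_scale span_base) auto

lemma lookup_fvec: "Poly_Mapping.lookup (fvec N \<alpha> i) {j} = (if j \<in> {1..N} then \<alpha> i j else 0)"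
  by (simp add: fvec_def lookup_sum ext_lookup_scaleR evec_def lookup_single when_def
      if_distrib[of "\<lambda>x. _ * x"] sum.delta cong: if_cong)

lemma lookup_wedge_vector:
  assumes "finite W" "x \<in> span (range evec)"
  shows "Poly_Mapping.lookup (wedge x z) W =
    (\<Sum>j\<in>W. ext_sign {j} (W - {j}) * Poly_Mapping.lookup x {j} * Poly_Mapping.lookup z (W - {j}))"
proof -
  let ?t = "\<lambda>S. ext_sign S (W - S) * Poly_Mapping.lookup x S * Poly_Mapping.lookup z (W - S)"
  have "Poly_Mapping.lookup (wedge x z) W = (\<Sum>S\<in>(\<lambda>j. {j}) ` W. ?t S)"
    unfolding lookup_wedge[OF assms(1)]
    using assms(1) keys_span_evec[OF assms(2)]
    by (intro sum.mono_neutral_right) (auto simp: in_keys_iff subset_iff image_iff)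
  then show ?thesis
    by (simp add: sum.reindex)
qed

text \<open>Multiplying by one more vector from the left is a step of Laplace expansion. Hence the
  coordinates of f_T are polynomial in the matrix entries, which is how genericity comes in.\<close>

lemma lookup_wedges_fvec:
  assumes "W \<subseteq> {1..N}"
  shows "Poly_Mapping.lookup (wedges (map (fvec N \<alpha>) ts)) W = minor (\<lambda>(i, j). \<alpha> i j) ts W"
  using assms
proof (induction ts arbitrary: W)
  case Nil
  then show ?case by (simp add: lookup_single when_def)
next
  case (Cons t ts)
  have "finite W" using Cons.prems finite_subset by blast
  moreover have "fvec N \<alpha> t \<in> span (range evec)"
    using fvec_in_span span_mono[of "evec ` {1..N}" "range evec"] by blast
  moreover have "j \<in> {1..N}" "W - {j} \<subseteq> {1..N}" if "j \<in> W" for j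
    using Cons.prems that by auto
  ultimately show ?case
    by (simp add: lookup_wedge_vector lookup_fvec Cons.IH del: atLeastAtMost_iff)
qed

lemma lookup_wedge_over_fvec:
  "W \<subseteq> {1..N} \<Longrightarrow> Poly_Mapping.lookup (wedge_over (fvec N \<alpha>) T) W =
    minor (\<lambda>(i, j). \<alpha> i j) (sorted_list_of_set T) W"
  by (simp add: wedge_over_eq_wedges lookup_wedges_fvec)

section \<open>Shifting as a rank condition\<close>

text \<open>Restriction of the coordinates to the faces of \<open>K\<close>. It models the quotient
  by the nonface ideal, which is its kernel in \<open>ext_alg\<close>.\<close>

definition proj :: "nat set set \<Rightarrow> ext \<Rightarrow> ext" where
  "proj K x = (\<Sum>T\<in>K. Poly_Mapping.single T (Poly_Mapping.lookup x T))"

lemma lookup_proj: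
  "finite K \<Longrightarrow> Poly_Mapping.lookup (proj K x) T = (if T \<in> K then Poly_Mapping.lookup x T else 0)"
  by (simp add: proj_def lookup_sum lookup_single when_def)

lemma linear_proj: "linear (proj K)"
  by (rule linearI)
    (simp_all add: proj_def lookup_add single_add sum.distrib ext_lookup_scaleR scaleR_sum_right
      scaleR_single)

lemma proj_eq_0_iff:
  assumes "finite K"
  shows "proj K x = 0 \<longleftrightarrow> (\<forall>T\<in>K. Poly_Mapping.lookup x T = 0)"
proof
  assume 0: "proj K x = 0"
  show "\<forall>T\<in>K. Poly_Mapping.lookup x T = 0"
  proof
    fix T assume "T \<in> K"
    then show "Poly_Mapping.lookup x T = 0" using lookup_proj[OF assms, of x T] 0 by simp
  qed
qed (simp add: proj_def)

lemma mem_subspace_if_keys: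
  fixes x :: ext
  assumes "subspace J" "\<And>T. T \<in> Poly_Mapping.keys x \<Longrightarrow> Poly_Mapping.single T 1 \<in> J"
  shows "x \<in> J"
proof -
  have "x = (\<Sum>T\<in>Poly_Mapping.keys x. Poly_Mapping.lookup x T *\<^sub>R Poly_Mapping.single T 1)"
    by (subst poly_mapping_eq_sum_single) (simp add: scaleR_single)
  also have "\<dots> \<in> J"
    using assms by (intro subspace_sum subspace_scale) auto
  finally show ?thesis .
qed

text \<open>Vanishing on \<open>K\<close> is preserved by products because both parts of a split
  face are faces again. Conversely, an element vanishing on \<open>K\<close> is a combination of
  basis vectors of nonfaces, which lie in every ideal of the intersection.\<close>

lemma nonface_ideal_eq:
  assumes "simplicial_complex K"
  shows "nonface_ideal N K = {x \<in> ext_alg N. proj K x = 0}" (is "_ = ?J")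
proof
  have finK: "finite K" and down: "\<And>S T. S \<in> K \<Longrightarrow> T \<subseteq> S \<Longrightarrow> T \<in> K" and fin: "\<And>S. S \<in> K \<Longrightarrow> finite S"
    using assms by (auto simp: simplicial_complex_def)
  have alg: "subspace (ext_alg N)"
    unfolding ext_alg_def by (rule subspace_keys_subset)
  have "?J = ext_alg N \<inter> {x. proj K x = 0}" by blast
  then have sub: "subspace ?J"
    using subspace_inter[OF alg linear_subspace_kernel[OF linear_proj[of K]]] by simp
  have mult: "proj K (wedge x y) = 0" if "proj K x = 0 \<or> proj K y = 0" for x y
    unfolding proj_eq_0_iff[OF finK]
  proof
    fix T assume T: "T \<in> K"
    have "Poly_Mapping.lookup x S = 0 \<or> Poly_Mapping.lookup y (T - S) = 0" if "S \<in> Pow T" for S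
      using that \<open>proj K x = 0 \<or> proj K y = 0\<close> down[OF T] proj_eq_0_iff[OF finK] by blast
    then show "Poly_Mapping.lookup (wedge x y) T = 0"
      unfolding lookup_wedge[OF fin[OF T]] by (intro sum.neutral) auto
  qed
  have closed: "wedge x y \<in> ext_alg N" if "x \<in> ext_alg N" "y \<in> ext_alg N" for x y
  proof -
    have "W \<subseteq> {1..N}" if "W \<in> Poly_Mapping.keys (wedge x y)" for W
      using that \<open>x \<in> ext_alg N\<close> \<open>y \<in> ext_alg N\<close>
      by (elim keys_wedge) (auto simp: ext_alg_def)
    then show ?thesis by (auto simp: ext_alg_def)
  qed
  have "ext_ideal N ?J"
    unfolding ext_ideal_def using sub mult closed by blast
  moreover have "wedge_over evec T \<in> ?J" if "T \<subseteq> {1..N}" "T \<notin> K" for T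
  proof -
    have "finite T" using that(1) finite_subset by blast
    then show ?thesis
      using that by (auto simp: wedge_over_evec ext_alg_def proj_eq_0_iff[OF finK] lookup_single when_def)
  qed
  ultimately show "nonface_ideal N K \<subseteq> ?J"
    unfolding nonface_ideal_def by blast
  show "?J \<subseteq> nonface_ideal N K"
    unfolding nonface_ideal_def
  proof (intro subsetI InterI)
    fix x J assume x: "x \<in> ?J"
      and "J \<in> {J. ext_ideal N J \<and> (\<forall>T. T \<subseteq> {1..N} \<longrightarrow> T \<notin> K \<longrightarrow> wedge_over evec T \<in> J)}"
    then have J: "subspace J" "\<And>T. T \<subseteq> {1..N} \<Longrightarrow> T \<notin> K \<Longrightarrow> wedge_over evec T \<in> J"
      by (auto simp: ext_ideal_def)
    show "x \<in> J"
    proof (rule mem_subspace_if_keys[OF J(1)])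
      fix T assume T: "T \<in> Poly_Mapping.keys x"
      then have "T \<subseteq> {1..N}" using x by (auto simp: ext_alg_def)
      moreover have "T \<notin> K" using x T proj_eq_0_iff[OF finK] by (auto simp: in_keys_iff)
      moreover have "finite T" using calculation(1) finite_subset by blast
      ultimately show "Poly_Mapping.single T 1 \<in> J" using J(2)[of T] by (simp add: wedge_over_evec)
    qed
  qed
qed

lemma ext_coset_eq_iff:
  assumes "subspace J"
  shows "ext_coset J x = ext_coset J y \<longleftrightarrow> x - y \<in> J"
proof
  assume "ext_coset J x = ext_coset J y"
  moreover have "x \<in> ext_coset J x"
    unfolding ext_coset_def using subspace_0[OF assms] by force
  ultimately obtain z where "z \<in> J" "x = y + z" by (auto simp: ext_coset_def)
  then show "x - y \<in> J" by simp
next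
  have *: "ext_coset J x \<subseteq> ext_coset J y" if "x - y \<in> J" for x y
  proof
    fix w assume "w \<in> ext_coset J x"
    then obtain z where "z \<in> J" "w = x + z" by (auto simp: ext_coset_def)
    then have "w = y + ((x - y) + z)" "(x - y) + z \<in> J"
      using that subspace_add[OF assms] by auto
    then show "w \<in> ext_coset J y" unfolding ext_coset_def by blast
  qed
  assume "x - y \<in> J"
  moreover have "y - x \<in> J" using subspace_neg[OF assms \<open>x - y \<in> J\<close>] by simp
  ultimately show "ext_coset J x = ext_coset J y" using * by blast
qed

lemma wedge_over_fvec_in_ext_alg: "finite T \<Longrightarrow> wedge_over (fvec N \<alpha>) T \<in> ext_alg N"
  using keys_wedge_over(2)[of T "fvec N \<alpha>" "{1..N}"] fvec_in_span by (auto simp: ext_alg_def)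

text \<open>The model of the class of f_S in the exterior face space of \<open>K\<close>.\<close>

definition shift_vec :: "nat \<Rightarrow> (nat \<Rightarrow> nat \<Rightarrow> real) \<Rightarrow> nat set set \<Rightarrow> nat set \<Rightarrow> ext" where
  "shift_vec N \<alpha> K S = proj K (wedge_over (fvec N \<alpha>) S)"

text \<open>Cosets agree exactly when the projections do, and a linear map commutes with spans, so
  the quotient can be replaced by \<open>proj K\<close>.\<close>

lemma alg_shift_iff:
  assumes "simplicial_complex K"
  shows "S \<in> alg_shift N \<alpha> K \<longleftrightarrow> S \<subseteq> {1..N} \<and>
    shift_vec N \<alpha> K S \<notin>
      span (shift_vec N \<alpha> K ` {S'. S' \<subseteq> {1..N} \<and> card S' = card S \<and> lex_less S' S})"
proof (cases "S \<subseteq> {1..N}")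
  case True
  let ?f = "wedge_over (fvec N \<alpha>)" and ?B = "{S'. S' \<subseteq> {1..N} \<and> card S' = card S \<and> lex_less S' S}"
  let ?J = "nonface_ideal N K"
  have alg: "subspace (ext_alg N)"
    unfolding ext_alg_def by (rule subspace_keys_subset)
  have J: "?J = ext_alg N \<inter> {x. proj K x = 0}"
    using nonface_ideal_eq[OF assms] by auto
  have sub: "subspace ?J"
    using subspace_inter[OF alg linear_subspace_kernel[OF linear_proj[of K]]] by (simp add: J)
  have fS: "?f S \<in> ext_alg N"
    using True finite_subset by (intro wedge_over_fvec_in_ext_alg) blast
  have "?f ` ?B \<subseteq> ext_alg N"
    using wedge_over_fvec_in_ext_alg finite_subset[OF _ finite_atLeastAtMost] by blast
  then have B: "span (?f ` ?B) \<subseteq> ext_alg N"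
    by (rule span_minimal[OF _ alg])
  have "ext_coset ?J (?f S) \<in> ext_coset ?J ` span (?f ` ?B) \<longleftrightarrow>
      (\<exists>y\<in>span (?f ` ?B). proj K (?f S) = proj K y)"
  proof -
    have "ext_coset ?J (?f S) = ext_coset ?J y \<longleftrightarrow> proj K (?f S) = proj K y"
      if "y \<in> span (?f ` ?B)" for y
    proof -
      have "?f S - y \<in> ext_alg N" using subspace_diff[OF alg fS] that B by blast
      then have "?f S - y \<in> ?J \<longleftrightarrow> proj K (?f S) = proj K y"
        by (simp add: J linear_diff[OF linear_proj])
      then show ?thesis unfolding ext_coset_eq_iff[OF sub] .
    qed
    then show ?thesis by blast
  qed
  also have "\<dots> \<longleftrightarrow> proj K (?f S) \<in> span (proj K ` ?f ` ?B)"
    unfolding linear_span_image[OF linear_proj] by blast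
  finally show ?thesis
    using True by (simp add: alg_shift_def shift_vec_def[abs_def] setcompr_eq_image image_image)
qed (simp add: alg_shift_def)

section \<open>The lexicographic order as an order of integers\<close>

lemma lex_less_iff:
  assumes "finite S" "finite T"
  shows "lex_less S T \<longleftrightarrow> (\<exists>m\<in>S - T. \<forall>x<m. x \<in> S \<longleftrightarrow> x \<in> T)"
proof
  let ?D = "(S - T) \<union> (T - S)"
  assume L: "lex_less S T"
  then have D: "?D \<noteq> {}" "finite ?D" using assms by (auto simp: lex_less_def)
  then have "Min ?D \<in> ?D" by (intro Min_in)
  then have "Min ?D \<in> S - T" using L by (auto simp: lex_less_def)
  moreover have "x \<in> S \<longleftrightarrow> x \<in> T" if "x < Min ?D" for x
    using Min_le[OF D(2), of x] that by force
  ultimately show "\<exists>m\<in>S - T. \<forall>x<m. x \<in> S \<longleftrightarrow> x \<in> T" by blast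
next
  assume "\<exists>m\<in>S - T. \<forall>x<m. x \<in> S \<longleftrightarrow> x \<in> T"
  then obtain m where m: "m \<in> S - T" "\<forall>x<m. x \<in> S \<longleftrightarrow> x \<in> T" by blast
  have "Min ((S - T) \<union> (T - S)) = m"
    using m assms by (intro Min_eqI) (auto simp: not_less[symmetric])
  then show "lex_less S T" using m by (auto simp: lex_less_def)
qed

text \<open>The characteristic vector of \<open>S\<close> read as a binary number with 1 as its
  leading position. The minus sign puts sets with small elements first.\<close>

definition lex_key :: "nat \<Rightarrow> nat set \<Rightarrow> int" where
  "lex_key N S = - (\<Sum>x\<in>S. 2 ^ (N - x))"

lemma sum_pow2_less:
  assumes "B \<subseteq> {m<..N}"
  shows "(\<Sum>x\<in>B. 2 ^ (N - x)) < (2 ^ (N - m) :: int)"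
proof -
  have "(\<Sum>x\<in>B. 2 ^ (N - x)) \<le> (\<Sum>x\<in>{m<..N}. 2 ^ (N - x) :: int)"
    using assms by (intro sum_mono2) auto
  also have "\<dots> = (\<Sum>k<N - m. 2 ^ k)"
    by (rule sum.reindex_bij_witness[of _ "\<lambda>k. N - k" "\<lambda>x. N - x"]) auto
  also have "\<dots> < 2 ^ (N - m)"
  proof -
    have "(\<Sum>k<n. 2 ^ k) < (2 ^ n :: int)" for n
      by (induction n) simp_all
    then show ?thesis .
  qed
  finally show ?thesis .
qed

text \<open>At the first difference \<open>m\<close> the set \<open>S\<close> has a digit that
  outweighs all digits of \<open>T - S\<close> together, as these come later.\<close>

lemma lex_less_imp_key_less:
  assumes "S \<subseteq> {1..N}" "T \<subseteq> {1..N}" "lex_less S T"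
  shows "lex_key N S < lex_key N T"
proof -
  have fin: "finite S" "finite T" using assms finite_subset by blast+
  then obtain m where m: "m \<in> S - T" "\<forall>x<m. x \<in> S \<longleftrightarrow> x \<in> T"
    using assms(3) lex_less_iff by blast
  let ?w = "\<lambda>x. 2 ^ (N - x) :: int"
  have "T - S \<subseteq> {m<..N}"
  proof
    fix x assume "x \<in> T - S"
    then show "x \<in> {m<..N}"
      using m assms(2) by (cases x m rule: linorder_cases) auto
  qed
  then have "sum ?w (T - S) < ?w m" by (rule sum_pow2_less)
  also have "\<dots> \<le> sum ?w (S - T)"
    using m fin by (intro member_le_sum) auto
  finally have "sum ?w (T \<inter> S) + sum ?w (T - S) < sum ?w (S \<inter> T) + sum ?w (S - T)"
    by (simp add: Int_commute)
  then show ?thesis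
    using fin by (simp add: lex_key_def sum.Int_Diff[symmetric])
qed

lemma lex_less_total:
  assumes "finite S" "finite T" "S \<noteq> T"
  shows "lex_less S T \<or> lex_less T S"
proof -
  have "Min ((S - T) \<union> (T - S)) \<in> (S - T) \<union> (T - S)"
    using assms by (intro Min_in) auto
  then show ?thesis using assms(3) by (auto simp: lex_less_def Un_commute)
qed

lemma lex_less_iff_key:
  assumes "S \<subseteq> {1..N}" "T \<subseteq> {1..N}"
  shows "lex_less S T \<longleftrightarrow> lex_key N S < lex_key N T"
proof -
  have fin: "finite S" "finite T" using assms finite_subset by blast+
  show ?thesis
    using lex_less_imp_key_less[OF assms] lex_less_imp_key_less[OF assms(2,1)]
      lex_less_total[OF fin] by force
qed

lemma inj_on_lex_key: "inj_on (lex_key N) (Pow {1..N})"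
proof (rule inj_onI, rule ccontr)
  fix S T assume *: "S \<in> Pow {1..N}" "T \<in> Pow {1..N}" "lex_key N S = lex_key N T" "S \<noteq> T"
  then have "finite S" "finite T" by (auto intro: finite_subset)
  with * show False
    using lex_less_total[of S T] lex_less_iff_key[of S N T] lex_less_iff_key[of T N S] by auto
qed

text \<open>Greedy choice of a basis: running through \<open>A\<close> by increasing key, the
  vectors outside the span of their predecessors form a basis of the span of all. This turns the
  counting of shifted faces into a dimension.\<close>

lemma card_new_directions:
  fixes g :: "'a \<Rightarrow> 'v :: real_vector" and key :: "'a \<Rightarrow> int"
  assumes "finite A" "inj_on key A"
  shows "card {t \<in> A. g t \<notin> span (g ` {t' \<in> A. key t' < key t})} = dim (g ` A)"
proof -
  define D where "D A = {t \<in> A. g t \<notin> span (g ` {t' \<in> A. key t' < key t})}" for A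
  have "independent (g ` D A) \<and> inj_on g (D A) \<and> span (g ` D A) = span (g ` A)"
    using assms
  proof (induction A rule: finite_ranking_induct[where f = key])
    case empty
    then show ?case by (simp add: D_def independent_empty)
  next
    case (insert x A)
    show ?case
    proof (cases "x \<in> A")
      case True
      then show ?thesis using insert by (simp add: insert_absorb)
    next
      case False
      have IH: "independent (g ` D A)" "inj_on g (D A)" "span (g ` D A) = span (g ` A)"
        using insert by (auto simp: inj_on_insert)
      \<comment> \<open>The ranking induction adds an element of maximal key; injectivity makes the
        maximum strict, so the predecessors of the earlier elements do not change.\<close>
      have lt: "key t < key x" if "t \<in> A" for t
      proof -
        have "key t \<noteq> key x" using insert.prems that False by (auto simp: inj_on_def)
        then show ?thesis using insert.hyps(2)[OF that] by simp
      qed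
      then have 1: "{t' \<in> insert x A. key t' < key x} = A"
        using False by auto
      have 2: "{t' \<in> insert x A. key t' < key t} = {t' \<in> A. key t' < key t}" if "t \<in> A" for t
        using lt[OF that] by auto
      have "{t \<in> insert x A. P t} = (if P x then insert x {t \<in> A. P t} else {t \<in> A. P t})" for P
        by auto
      then have D: "D (insert x A) = (if g x \<notin> span (g ` A) then insert x (D A) else D A)"
        unfolding D_def using 1 2 by (simp cong: conj_cong)
      show ?thesis
      proof (cases "g x \<in> span (g ` A)")
        case True
        then show ?thesis using IH D by (simp add: span_redundant)
      next
        case nin: False
        then have nin': "g x \<notin> span (g ` D A)" using IH by simp
        then have "g x \<notin> g ` D A" using span_base by blast
        then show ?thesis
          using IH D nin nin' independent_insertI[OF nin' IH(1)]
          by (auto simp: inj_on_insert span_insert)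
      qed
    qed
  qed
  then have "independent (g ` D A)" "inj_on g (D A)" "span (g ` D A) = span (g ` A)" by auto
  then show ?thesis
    using dim_eq_card[of "g ` D A" "g ` A"] by (simp add: card_image D_def)
qed

section \<open>Generic matrices\<close>

text \<open>Coefficients are indexed by \<open>A\<close> and not by the image, so repeated values of
  \<open>g\<close> do no harm and membership is a linear system in the form of the transfer
  lemmas.\<close>

lemma mem_span_image_iff:
  fixes g :: "'a \<Rightarrow> 'v :: real_vector"
  assumes "finite A"
  shows "x \<in> span (g ` A) \<longleftrightarrow> (\<exists>c. x = (\<Sum>t\<in>A. c t *\<^sub>R g t))"
proof
  have "subspace {x. \<exists>c. x = (\<Sum>t\<in>A. c t *\<^sub>R g t)}" (is "subspace ?U")
  proof (rule subspaceI)
    show "0 \<in> ?U" by (auto intro!: exI[of _ "\<lambda>_. 0"])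
    show "x + y \<in> ?U" if xy: "x \<in> ?U" "y \<in> ?U" for x y
    proof -
      obtain c d where "x = (\<Sum>t\<in>A. c t *\<^sub>R g t)" "y = (\<Sum>t\<in>A. d t *\<^sub>R g t)" using xy by blast
      then have "x + y = (\<Sum>t\<in>A. (c t + d t) *\<^sub>R g t)"
        by (simp add: scaleR_left_distrib sum.distrib)
      then show ?thesis by (intro CollectI exI[of _ "\<lambda>t. c t + d t"])
    qed
    show "k *\<^sub>R x \<in> ?U" if x: "x \<in> ?U" for k x
    proof -
      obtain c where "x = (\<Sum>t\<in>A. c t *\<^sub>R g t)" using x by blast
      then have "k *\<^sub>R x = (\<Sum>t\<in>A. (k * c t) *\<^sub>R g t)"
        by (simp add: scaleR_sum_right)
      then show ?thesis by (intro CollectI exI[of _ "\<lambda>t. k * c t"])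
    qed
  qed
  moreover have "g ` A \<subseteq> ?U"
  proof
    fix y assume "y \<in> g ` A"
    then obtain s where s: "s \<in> A" "y = g s" by blast
    have "(\<Sum>t\<in>A. (if t = s then 1 else 0) *\<^sub>R g t) = (\<Sum>t\<in>A. if t = s then g t else 0)"
      by (intro sum.cong) auto
    also have "\<dots> = y" using s assms by simp
    finally show "y \<in> ?U" by (intro CollectI exI[of _ "\<lambda>t. if t = s then 1 else 0"]) (rule sym)
  qed
  ultimately have "span (g ` A) \<subseteq> ?U" by (intro span_minimal)
  then show "x \<in> span (g ` A) \<Longrightarrow> \<exists>c. x = (\<Sum>t\<in>A. c t *\<^sub>R g t)" by blast
next
  assume "\<exists>c. x = (\<Sum>t\<in>A. c t *\<^sub>R g t)"
  then obtain c where "x = (\<Sum>t\<in>A. c t *\<^sub>R g t)" by blast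
  moreover have "(\<Sum>t\<in>A. c t *\<^sub>R g t) \<in> span (g ` A)"
    by (intro span_sum span_scale span_base imageI)
  ultimately show "x \<in> span (g ` A)" by simp
qed

lemma independent_image_if_scalars_zero:
  fixes g :: "'a \<Rightarrow> 'v :: real_vector"
  assumes "finite A" and zero: "\<And>c. (\<Sum>t\<in>A. c t *\<^sub>R g t) = 0 \<Longrightarrow> \<forall>t\<in>A. c t = 0"
  shows "inj_on g A" "independent (g ` A)"
proof -
  show inj: "inj_on g A"
  proof (rule inj_onI, rule ccontr)
    fix s t assume st: "s \<in> A" "t \<in> A" "g s = g t" "s \<noteq> t"
    \<comment> \<open>Two indices with the same vector give the nontrivial relation with
      coefficients 1 and -1.\<close>
    let ?c = "\<lambda>x. (if x = s then 1 else 0) - (if x = t then 1 else 0) :: real"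
    have "(\<Sum>x\<in>A. ?c x *\<^sub>R g x) = (\<Sum>x\<in>A. (if x = s then g x else 0) - (if x = t then g x else 0))"
      by (intro sum.cong) auto
    also have "\<dots> = 0" using st assms(1) by (simp add: sum_subtractf)
    finally have "\<forall>x\<in>A. ?c x = 0" by (rule zero)
    with bspec[OF this st(1)] st(4) show False by simp
  qed
  show "independent (g ` A)"
  proof (rule independent_if_scalars_zero)
    fix c x assume c: "(\<Sum>x\<in>g ` A. c x *\<^sub>R x) = 0" and x: "x \<in> g ` A"
    have "\<forall>t\<in>A. c (g t) = 0"
      using c by (intro zero) (simp add: sum.reindex[OF inj])
    with x show "c x = 0" by blast
  qed (use assms in simp)
qed

text \<open>A strictly increasing relabelling keeps the factors sorted, so no sign appears.\<close>

lemma wedge_over_evec_image: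
  assumes "finite T" "strict_mono_on T e"
  shows "wedge_over (\<lambda>i. evec (e i)) T = Poly_Mapping.single (e ` T) 1"
proof -
  have "sorted_wrt (<) (map e (sorted_list_of_set T))"
    unfolding sorted_wrt_map
    by (rule sorted_wrt_mono_rel[OF _ strict_sorted_list_of_set])
      (use assms in \<open>auto simp: strict_mono_on_def\<close>)
  then have "sorted_list_of_set (set (map e (sorted_list_of_set T))) = map e (sorted_list_of_set T)"
    by (simp only: sorted_list_of_set.idem_if_sorted_distinct strict_sorted_iff)
  then have "sorted_list_of_set (e ` T) = map e (sorted_list_of_set T)"
    using assms(1) by simp
  then have "wedge_over (\<lambda>i. evec (e i)) T = wedge_over evec (e ` T)"
    by (simp add: wedge_over_eq_wedges o_def)
  then show ?thesis
    using assms(1) by (simp add: wedge_over_evec)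
qed

lemma wedge_over_cong: "finite T \<Longrightarrow> (\<And>i. i \<in> T \<Longrightarrow> v i = w i) \<Longrightarrow> wedge_over v T = wedge_over w T"
  unfolding wedge_over_eq_wedges by (intro arg_cong[of _ _ wedges] map_cong) auto

lemma ex_strict_mono_enumeration:
  fixes V :: "nat set"
  assumes "finite V"
  shows "\<exists>e. strict_mono_on {1..card V} e \<and> e ` {1..card V} = V"
proof -
  let ?xs = "sorted_list_of_set V"
  have len: "length ?xs = card V" by simp
  have "strict_mono_on {1..card V} (\<lambda>i. ?xs ! (i - 1))"
  proof (rule strict_mono_onI)
    fix i j assume "i \<in> {1..card V}" "j \<in> {1..card V}" "i < j"
    then show "?xs ! (i - 1) < ?xs ! (j - 1)"
      by (intro sorted_wrt_nth_less[OF strict_sorted_list_of_set]) auto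
  qed
  moreover have "(\<lambda>i. ?xs ! (i - 1)) ` {1..card V} = V"
  proof -
    have "{1..card V} = Suc ` {..<card V}" by (auto simp: image_iff Suc_le_eq gr0_conv_Suc)
    then have "(\<lambda>i. ?xs ! (i - 1)) ` {1..card V} = (!) ?xs ` {..<length ?xs}"
      by (simp add: image_image)
    also have "\<dots> = set ?xs" by (auto simp: set_conv_nth)
    finally show ?thesis using assms by simp
  qed
  ultimately show ?thesis by blast
qed

text \<open>It suffices to exhibit one matrix for which the vectors are independent; we take the one
  whose first rows are the unit vectors indexed by \<open>V\<close>.\<close>

lemma generic_wedges_independent:
  assumes gen: "generic N \<alpha>" and V: "V \<subseteq> {1..N}"
  shows "inj_on (shift_vec N \<alpha> (Pow V)) (Pow {1..card V})"
    and "independent (shift_vec N \<alpha> (Pow V) ` Pow {1..card V})"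
proof -
  have finV: "finite V" using V finite_subset by blast
  obtain e where e: "strict_mono_on {1..card V} e" "e ` {1..card V} = V"
    using ex_strict_mono_enumeration[OF finV] by blast
  let ?A = "Pow {1..card V}" and ?E = "Pow V"
  let ?v = "\<lambda>T W a. minor a (sorted_list_of_set T) W"
  define \<beta> where "\<beta> i j = (if j = e i then 1 else 0 :: real)" for i j
  have sV: "card V \<le> N" using card_mono[OF _ V] by simp
  have zero: "\<forall>T\<in>?A. c T = 0" if c: "(\<Sum>T\<in>?A. c T *\<^sub>R shift_vec N \<alpha> (Pow V) T) = 0" for c
  proof (rule generic_independence_transfer[where E = ?E and v = ?v and b = "\<lambda>(i, j). \<beta> i j"])
    show "finite ?A" by simp
    show "polyfun ({1..N} \<times> {1..N}) (?v T W)" if "T \<in> ?A" "W \<in> ?E" for T W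
    proof (rule polyfun_minor)
      have "finite T" using that(1) by (auto intro: finite_subset)
      then have "set (sorted_list_of_set T) = T" by simp
      moreover have "T \<subseteq> {1..N}" using that(1) sV by force
      ultimately show "set (sorted_list_of_set T) \<times> W \<subseteq> {1..N} \<times> {1..N}"
        using that(2) V by auto
    qed
    show "alg_independent ({1..N} \<times> {1..N}) (\<lambda>(i, j). \<alpha> i j)"
      using gen by (simp add: generic_def)
    show "\<forall>T\<in>?A. d T = 0"
      if d: "\<forall>W\<in>?E. (\<Sum>T\<in>?A. d T * minor (\<lambda>(i, j). \<beta> i j) (sorted_list_of_set T) W) = 0" for d
    proof
      fix T0 assume T0: "T0 \<in> ?A"
      \<comment> \<open>At \<beta> the product over \<open>T\<close> is the basis vector of the
        image of \<open>T\<close> under \<open>e\<close>, so the matrix of coordinates at such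
        images is the identity and a relation can be read off entry by entry.\<close>
      have eq: "minor (\<lambda>(i, j). \<beta> i j) (sorted_list_of_set T) (e ` T0) = (if T = T0 then 1 else 0)"
        if T: "T \<in> ?A" for T
      proof -
        have finT: "finite T" using T by (auto intro: finite_subset)
        have "fvec N \<beta> i = evec (e i)" if "i \<in> T" for i
        proof -
          have "e i \<in> e ` {1..card V}" using that T by (intro imageI) blast
          then have "e i \<in> {1..N}" using e(2) V by blast
          moreover have "fvec N \<beta> i = (\<Sum>j=1..N. if j = e i then evec j else 0)"
            unfolding fvec_def \<beta>_def by (intro sum.cong) auto
          ultimately show ?thesis by simp
        qed
        then have "wedge_over (fvec N \<beta>) T = wedge_over (\<lambda>i. evec (e i)) T"
          by (intro wedge_over_cong[OF finT])
        also have "\<dots> = Poly_Mapping.single (e ` T) 1"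
          using T monotone_on_subset[OF e(1)] by (intro wedge_over_evec_image[OF finT]) auto
        finally have "wedge_over (fvec N \<beta>) T = Poly_Mapping.single (e ` T) 1" .
        moreover have "e ` T0 \<subseteq> {1..N}" using T0 e(2) V by auto
        ultimately have "minor (\<lambda>(i, j). \<beta> i j) (sorted_list_of_set T) (e ` T0) =
            (if e ` T = e ` T0 then 1 else 0)"
          using lookup_wedge_over_fvec[of "e ` T0" N \<beta> T] by (simp add: lookup_single when_def)
        moreover have "e ` T = e ` T0 \<longleftrightarrow> T = T0"
          using inj_on_image_eq_iff[OF strict_mono_on_imp_inj_on[OF e(1)], of T T0] T T0 by simp
        ultimately show ?thesis by simp
      qed
      have "e ` T0 \<in> ?E" using T0 e(2) by auto
      from bspec[OF d this] have "0 =
          (\<Sum>T\<in>?A. d T * minor (\<lambda>(i, j). \<beta> i j) (sorted_list_of_set T) (e ` T0))"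
        by (rule sym)
      also have "\<dots> = (\<Sum>T\<in>?A. d T * (if T = T0 then 1 else 0))"
        by (rule sum.cong) (simp_all only: eq)
      finally show "d T0 = 0"
        using T0 by (simp add: if_distrib[of "\<lambda>u. _ * u"] sum.delta' cong: if_cong)
    qed
    show "\<forall>W\<in>?E. (\<Sum>T\<in>?A. c T * minor (\<lambda>(i, j). \<alpha> i j) (sorted_list_of_set T) W) = 0"
    proof
      fix W assume W: "W \<in> ?E"
      have "Poly_Mapping.lookup (\<Sum>T\<in>?A. c T *\<^sub>R shift_vec N \<alpha> (Pow V) T) W = 0"
        by (simp only: c lookup_zero)
      moreover have "W \<subseteq> {1..N}" using W V by auto
      ultimately show "(\<Sum>T\<in>?A. c T * minor (\<lambda>(i, j). \<alpha> i j) (sorted_list_of_set T) W) = 0"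
        using W finV
        by (simp add: lookup_sum ext_lookup_scaleR shift_vec_def lookup_proj lookup_wedge_over_fvec)
    qed
  qed
  then show "inj_on (shift_vec N \<alpha> (Pow V)) ?A" "independent (shift_vec N \<alpha> (Pow V) ` ?A)"
    using independent_image_if_scalars_zero[of ?A "shift_vec N \<alpha> (Pow V)"] by auto
qed

section \<open>Straightening the last factor\<close>

lemma wedge_over_singleton:
  assumes "v u \<in> span (range evec)"
  shows "wedge_over v {u} = v u"
proof -
  have lin: "linear (\<lambda>x. wedge x (Poly_Mapping.single {} 1))" "linear (\<lambda>x :: ext. x)"
    by (rule linear_wedge_left, rule linear_ident)
  have "wedge (v u) (Poly_Mapping.single {} 1) = v u"
    by (rule linear_eq_on_span[OF lin _ assms]) (auto simp: evec_def wedge_single ext_sign_def)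
  then show ?thesis by (simp add: wedge_over_eq_wedges)
qed

lemma proj_Pow_evec: "finite V \<Longrightarrow> proj (Pow V) (evec i) = (if i \<in> V then evec i else 0)"
  by (rule poly_mapping_eqI) (auto simp: lookup_proj evec_def lookup_single when_def)

text \<open>Restricted to \<open>V\<close>, the vectors f_1, f_2, ... up to index
  \<open>card V\<close> are independent in a space of that dimension, hence a basis. They produce
  \<open>evec j\<close> up to an error supported outside \<open>V\<close>.\<close>

lemma evec_in_span_generic:
  assumes gen: "generic N \<alpha>" and V: "V \<subseteq> {1..N}" and j: "j \<in> {1..N}"
  shows "evec j \<in> span (fvec N \<alpha> ` {1..card V} \<union> evec ` ({1..N} - V))"
proof (cases "j \<in> V")
  case False
  then show ?thesis using j by (intro span_base) auto
next
  case True
  have finV: "finite V" using V finite_subset by blast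
  let ?f = "fvec N \<alpha>" and ?P = "proj (Pow V)" and ?I = "{1..card V}"
  have f: "?f u \<in> span (evec ` {1..N})" for u by (rule fvec_in_span)
  have "?f u \<in> span (range evec)" for u
    using f span_mono[of "evec ` {1..N}" "range evec"] by blast
  then have shift: "shift_vec N \<alpha> (Pow V) {u} = ?P (?f u)" for u
    by (simp add: shift_vec_def wedge_over_singleton)
  have sub: "(\<lambda>u. {u}) ` ?I \<subseteq> Pow ?I" by auto
  \<comment> \<open>One-element sets turn the independence of the wedges into that of the
    vectors.\<close>
  have "independent (shift_vec N \<alpha> (Pow V) ` (\<lambda>u. {u}) ` ?I)"
    by (rule independent_mono[OF generic_wedges_independent(2)[OF gen V] image_mono[OF sub]])
  moreover have "inj_on (shift_vec N \<alpha> (Pow V)) ((\<lambda>u. {u}) ` ?I)"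
    using inj_on_subset[OF generic_wedges_independent(1)[OF gen V] sub] .
  ultimately have G: "independent (?P ` ?f ` ?I)" "card (?P ` ?f ` ?I) = card V"
    using card_image[of "shift_vec N \<alpha> (Pow V)" "(\<lambda>u. {u}) ` ?I"]
    by (simp_all add: image_image shift card_image)
  have PV: "?P y \<in> span (evec ` V)" if "y \<in> span (evec ` {1..N})" for y
  proof -
    have "?P y \<in> span (?P ` evec ` {1..N})"
      using that unfolding linear_span_image[OF linear_proj] by blast
    moreover have "span (?P ` evec ` {1..N}) \<subseteq> span (evec ` V)"
      by (rule span_minimal) (auto simp: proj_Pow_evec[OF finV] span_base span_zero)
    ultimately show ?thesis by blast
  qed
  have "evec j \<in> span (?P ` ?f ` ?I)"
  \<comment> \<open>Otherwise there would be \<open>card V + 1\<close> independent vectors in the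
    span of \<open>card V\<close> vectors.\<close>
  proof (rule ccontr)
    assume nin: "evec j \<notin> span (?P ` ?f ` ?I)"
    have "?P ` ?f ` ?I \<subseteq> span (evec ` V)" using PV f by blast
    moreover have "evec j \<in> span (evec ` V)" by (intro span_base imageI True)
    ultimately have "insert (evec j) (?P ` ?f ` ?I) \<subseteq> span (evec ` V)" by simp
    from independent_span_bound[OF finite_imageI[OF finV] independent_insertI[OF nin G(1)] this]
    have "card (insert (evec j) (?P ` ?f ` ?I)) \<le> card (evec ` V)" ..
    also have "\<dots> \<le> card V" using finV by (rule card_image_le)
    moreover have "evec j \<notin> ?P ` ?f ` ?I"
      using nin span_superset[of "?P ` ?f ` ?I"] by blast
    ultimately show False
      using G(2) by (simp add: card_insert_disjoint del: image_image)
  qed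
  then obtain y where y: "y \<in> span (?f ` ?I)" "evec j = ?P y"
    unfolding linear_span_image[OF linear_proj] by blast
  have "span (?f ` ?I) \<subseteq> span (evec ` {1..N})"
    using f by (intro span_minimal) auto
  then have yN: "y \<in> span (evec ` {1..N})" using y(1) by blast
  have lin: "linear (\<lambda>y. y - ?P y)"
    by (intro linear_compose_sub linear_ident linear_proj)
  have "y - ?P y \<in> span ((\<lambda>y. y - ?P y) ` evec ` {1..N})"
    using yN unfolding linear_span_image[OF lin] by blast
  moreover have "span ((\<lambda>y. y - ?P y) ` evec ` {1..N}) \<subseteq> span (evec ` ({1..N} - V))"
    by (rule span_minimal) (auto simp: proj_Pow_evec[OF finV] span_base span_zero)
  ultimately have "y - ?P y \<in> span (?f ` ?I \<union> evec ` ({1..N} - V))"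
    using span_mono[of "evec ` ({1..N} - V)" "?f ` ?I \<union> evec ` ({1..N} - V)"] by blast
  moreover have "y \<in> span (?f ` ?I \<union> evec ` ({1..N} - V))"
    using y(1) span_mono[of "?f ` ?I" "?f ` ?I \<union> evec ` ({1..N} - V)"] by blast
  ultimately have "y - (y - ?P y) \<in> span (?f ` ?I \<union> evec ` ({1..N} - V))"
    by (rule span_diff[rotated])
  then show ?thesis by (simp add: y(2))
qed

lemma lex_less_replace:
  assumes "finite T" "r \<in> T" "u \<notin> T" "u < r"
  shows "lex_less (insert u (T - {r})) T"
  using assms by (subst lex_less_iff) (auto intro!: bexI[of _ u])

text \<open>Modulo the vectors outside \<open>V\<close>, the last factor of \<open>f\<^sub>T\<close> is a combination of
  \<open>f\<^sub>1, \<dots>, f\<^bsub>|V|\<^esub>\<close>; exchanging it for one of these lowers \<open>T\<close> lexicographically.\<close>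

lemma wedge_over_straighten:
  assumes gen: "generic N \<alpha>" and V: "V \<subseteq> {1..N}" and T: "T \<subseteq> {1..N}"
  shows "wedge_over (fvec N \<alpha>) T \<in> span (
    wedge_over (fvec N \<alpha>) `
      {T'. T' \<subseteq> {1..card V} \<and> card T' = card T \<and> lex_key N T' \<le> lex_key N T} \<union>
    {wedge_over ((fvec N \<alpha>)(Max T' := evec j)) T' | T' j.
      T' \<subseteq> {1..N} \<and> T' \<noteq> {} \<and> card T' = card T \<and> lex_key N T' \<le> lex_key N T \<and>
      j \<in> {1..N} - V})"
    (is "_ \<in> span (?G T)")
  using T
\<comment> \<open>The measure counts the indices above \<open>card V\<close>. While there is one,
  the maximum of \<open>T\<close> is one, and exchanging it for an index up to \<open>card V\<close>
  lowers the count.\<close>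
proof (induction "card (T - {1..card V})" arbitrary: T rule: less_induct)
  case (less T)
  let ?f = "fvec N \<alpha>" and ?s = "card V"
  have finT: "finite T" using less.prems finite_subset by blast
  have sN: "?s \<le> N" using card_mono[OF _ V] by simp
  show ?case
  proof (cases "T \<subseteq> {1..?s}")
    case True
    then show ?thesis by (intro span_base) auto
  next
    case False
    then have ne: "T \<noteq> {}" by auto
    obtain t where t: "t \<in> T" "t \<notin> {1..?s}" using False by blast
    define r where "r = Max T"
    have r: "r \<in> T" using finT ne by (simp add: r_def)
    have "?s < t" using t less.prems by force
    also have "t \<le> r" using finT t by (simp add: r_def)
    finally have sr: "?s < r" .
    let ?B = "?f ` {1..?s} \<union> evec ` ({1..N} - V)"
    let ?\<Phi> = "\<lambda>x. wedge_over (?f(r := x)) T"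
    have lin: "linear ?\<Phi>" by (rule linear_wedge_over_update[OF finT r])
    have fr: "?f i \<in> span (range evec)" for i
      using fvec_in_span span_mono[of "evec ` {1..N}" "range evec"] by blast
    have "span (evec ` {1..N}) \<subseteq> span ?B"
      using evec_in_span_generic[OF gen V] by (intro span_minimal) auto
    then have "?f r \<in> span ?B" using fvec_in_span by blast
    then have "?\<Phi> (?f r) \<in> span (?\<Phi> ` ?B)"
      unfolding linear_span_image[OF lin] by (rule imageI)
    moreover have "?\<Phi> ` ?B \<subseteq> span (?G T)"
    proof (rule image_subsetI)
      fix b assume "b \<in> ?B"
      then consider u where "u \<in> {1..?s}" "b = ?f u" | j where "j \<in> {1..N} - V" "b = evec j"
        by blast
      then show "?\<Phi> b \<in> span (?G T)"
      proof cases
        case 1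
        let ?T = "insert u (T - {r})"
        obtain c where c: "?\<Phi> (?f u) = c *\<^sub>R wedge_over ?f ?T" "u \<in> T - {r} \<longrightarrow> c = 0"
          using wedge_over_replace[of ?f T r u] fr finT r by blast
        show ?thesis
        proof (cases "u \<in> T")
          case True
          then have "c = 0" using c(2) 1(1) sr by auto
          then show ?thesis using c(1) 1(2) span_zero by simp
        next
          case False
          have T': "?T \<subseteq> {1..N}" using less.prems 1(1) sN by auto
          have card: "card ?T = card T"
            using finT r False by (simp add: card.insert_remove card_Diff_singleton)
              (metis One_nat_def Suc_pred card_gt_0_iff empty_iff)
          have "u < r" using 1(1) sr by simp
          from lex_less_replace[OF finT r False this]
          have key: "lex_key N ?T \<le> lex_key N T"
            unfolding lex_less_iff_key[OF T' less.prems] by simp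
          have "?T - {1..?s} = (T - {1..?s}) - {r}"
            using 1(1) by auto
          moreover have "r \<in> T - {1..?s}" using r sr by auto
          ultimately have "card (?T - {1..?s}) < card (T - {1..?s})"
            using card_Diff1_less[of "T - {1..?s}" r] finT by simp
          from less.hyps[OF this T'] have "wedge_over ?f ?T \<in> span (?G ?T)" .
          \<comment> \<open>The generating families grow with the key of their bound, so the result
            for the smaller set can be used for \<open>T\<close>.\<close>
          moreover have "?G ?T \<subseteq> ?G T"
          proof (rule Un_mono)
            show "wedge_over ?f ` {T'. T' \<subseteq> {1..?s} \<and> card T' = card ?T \<and> lex_key N T' \<le> lex_key N ?T}
              \<subseteq> wedge_over ?f ` {T'. T' \<subseteq> {1..?s} \<and> card T' = card T \<and> lex_key N T' \<le> lex_key N T}"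
              unfolding card using order_trans[OF _ key] by (intro image_mono) blast
            show "{wedge_over (?f(Max T' := evec j)) T' | T' j. T' \<subseteq> {1..N} \<and> T' \<noteq> {} \<and>
                card T' = card ?T \<and> lex_key N T' \<le> lex_key N ?T \<and> j \<in> {1..N} - V}
              \<subseteq> {wedge_over (?f(Max T' := evec j)) T' | T' j. T' \<subseteq> {1..N} \<and> T' \<noteq> {} \<and>
                card T' = card T \<and> lex_key N T' \<le> lex_key N T \<and> j \<in> {1..N} - V}"
              unfolding card using order_trans[OF _ key] by blast
          qed
          ultimately have "wedge_over ?f ?T \<in> span (?G T)"
            by (rule subsetD[OF span_mono, rotated])
          then show ?thesis
            using c(1) 1(2) by (simp add: span_scale)
        qed
      next
        case 2
        then show ?thesis
          using less.prems ne unfolding r_def by (intro span_base) blast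
      qed
    qed
    ultimately have "?\<Phi> (?f r) \<in> span (?G T)"
      using span_minimal[OF _ subspace_span] by blast
    then show ?thesis by (simp only: fun_upd_triv)
  qed
qed

section \<open>Independence of the shift from the matrix\<close>

lemma face_subset_vertices: "simplicial_complex K \<Longrightarrow> W \<in> K \<Longrightarrow> W \<subseteq> vertices K"
  by (auto simp: simplicial_complex_def vertices_def)

text \<open>Every index set of the product contains \<open>j\<close>, and no face does.\<close>

lemma proj_wedge_over_eq_0:
  assumes "simplicial_complex K" "finite T" "r \<in> T" "j \<notin> vertices K"
  shows "proj K (wedge_over (v(r := evec j)) T) = 0"
proof -
  have "finite K" using assms(1) by (simp add: simplicial_complex_def)
  have "W \<notin> K" if "W \<in> Poly_Mapping.keys (wedge_over (v(r := evec j)) T)" for W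
  proof -
    have "W \<inter> {j} \<noteq> {}"
      by (rule keys_wedge_over_meet[OF assms(2,3) _ that]) (simp add: span_base)
    then show ?thesis using face_subset_vertices[OF assms(1)] assms(4) by blast
  qed
  then show ?thesis
    unfolding proj_eq_0_iff[OF \<open>finite K\<close>] by (auto simp: in_keys_iff)
qed

text \<open>Straightening with \<open>V\<close> the vertex set: the products with a last factor
  outside \<open>V\<close> project to 0. What remains involves only the rows in \<open>I\<close>, so
  matrices of different sizes become comparable.\<close>

lemma alg_shift_iff_generic:
  assumes K: "simplicial_complex K" and gen: "generic N \<alpha>" and V: "vertices K \<subseteq> {1..N}"
  defines "I \<equiv> {1..card (vertices K)}"
  shows "S \<in> alg_shift N \<alpha> K \<longleftrightarrow> S \<subseteq> I \<and>
    shift_vec N \<alpha> K S \<notin> span (shift_vec N \<alpha> K ` {S'. S' \<subseteq> I \<and> card S' = card S \<and> lex_less S' S})"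
proof -
  let ?g = "shift_vec N \<alpha> K"
  have "card (vertices K) \<le> N" using card_mono[OF _ V] by simp
  then have I: "I \<subseteq> {1..N}" by (auto simp: I_def)
  have straight: "?g T \<in> span (?g ` {T'. T' \<subseteq> I \<and> card T' = card T \<and> lex_key N T' \<le> lex_key N T})"
    (is "_ \<in> span (?g ` ?L T)") if T: "T \<subseteq> {1..N}" for T
  proof -
    let ?Z = "{wedge_over ((fvec N \<alpha>)(Max T' := evec j)) T' | T' j.
      T' \<subseteq> {1..N} \<and> T' \<noteq> {} \<and> card T' = card T \<and> lex_key N T' \<le> lex_key N T \<and>
      j \<in> {1..N} - vertices K}"
    have zero: "proj K z = 0" if zZ: "z \<in> ?Z" for z
    proof -
      obtain T' j where z: "z = wedge_over ((fvec N \<alpha>)(Max T' := evec j)) T'" "T' \<subseteq> {1..N}"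
        "T' \<noteq> {}" "j \<in> {1..N} - vertices K" using zZ by blast
      have "finite T'" using z(2) finite_subset by blast
      then show ?thesis
        unfolding z(1) using z(3,4) by (intro proj_wedge_over_eq_0[OF K]) auto
    qed
    have "proj K ` ?Z \<subseteq> span (?g ` ?L T)"
      by (rule image_subsetI) (simp only: zero span_zero)
    moreover have "proj K ` wedge_over (fvec N \<alpha>) ` ?L T \<subseteq> span (?g ` ?L T)"
      unfolding image_image shift_vec_def[symmetric] by (rule span_superset)
    ultimately have sub: "proj K ` (wedge_over (fvec N \<alpha>) ` ?L T \<union> ?Z) \<subseteq> span (?g ` ?L T)"
      unfolding image_Un by (rule Un_least[rotated])
    have "?g T \<in> span (proj K ` (wedge_over (fvec N \<alpha>) ` ?L T \<union> ?Z))"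
      unfolding linear_span_image[OF linear_proj] shift_vec_def I_def
      by (rule imageI[OF wedge_over_straighten[OF gen V T]])
    then show ?thesis
      by (rule subsetD[OF span_minimal[OF sub subspace_span]])
  qed
  let ?A = "{S'. S' \<subseteq> {1..N} \<and> card S' = card S \<and> lex_less S' S}"
  let ?B = "{S'. S' \<subseteq> I \<and> card S' = card S \<and> lex_less S' S}"
  have span_eq: "span (?g ` ?A) = span (?g ` ?B)" if S: "S \<subseteq> {1..N}"
  proof
    have "?g T \<in> span (?g ` ?B)" if T: "T \<in> ?A" for T
    proof -
      have "?L T \<subseteq> ?B"
      proof
        fix T' assume T': "T' \<in> ?L T"
        then have "T' \<subseteq> {1..N}" using I by blast
        then show "T' \<in> ?B"
          using T T' S lex_less_iff_key[of T' N S] lex_less_iff_key[of T N S] by auto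
      qed
      then have "span (?g ` ?L T) \<subseteq> span (?g ` ?B)" by (intro span_mono image_mono)
      with straight[of T] T show ?thesis by blast
    qed
    then show "span (?g ` ?A) \<subseteq> span (?g ` ?B)"
      by (intro span_minimal) auto
    show "span (?g ` ?B) \<subseteq> span (?g ` ?A)"
      using I by (intro span_mono image_mono) auto
  qed
  \<comment> \<open>A set outside \<open>I\<close> is different from all sets it straightens to, and
    keys are injective, so these are strictly smaller and it cannot be in the shift.\<close>
  have "?g S \<in> span (?g ` ?B)" if S: "S \<subseteq> {1..N}" "\<not> S \<subseteq> I"
  proof -
    have "?L S \<subseteq> ?B"
    proof
      fix T' assume T': "T' \<in> ?L S"
      then have "T' \<subseteq> {1..N}" "T' \<noteq> S" using I S by auto
      moreover from this have "lex_key N T' \<noteq> lex_key N S"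
        using inj_onD[OF inj_on_lex_key, of N T' S] S by auto
      ultimately show "T' \<in> ?B"
        using T' S lex_less_iff_key[of T' N S] by auto
    qed
    then have "span (?g ` ?L S) \<subseteq> span (?g ` ?B)" by (intro span_mono image_mono)
    with straight[of S] S show ?thesis by blast
  qed
  then show ?thesis
    unfolding alg_shift_iff[OF K] using span_eq I by blast
qed

lemma alg_shift_subset:
  assumes "simplicial_complex K" "generic N \<alpha>" "vertices K \<subseteq> {1..N}"
  shows "alg_shift N \<alpha> K \<subseteq> Pow {1..card (vertices K)}"
  using alg_shift_iff_generic[OF assms] by blast

text \<open>Compares coordinates on the faces, which gives the linear system with minors as entries
  required by \<open>generic_combination_transfer\<close>.\<close>

lemma shift_vec_mem_span_iff:
  assumes K: "simplicial_complex K" and V: "vertices K \<subseteq> {1..N}" and "finite A"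
  shows "shift_vec N \<alpha> K S \<in> span (shift_vec N \<alpha> K ` A) \<longleftrightarrow>
    (\<exists>c. \<forall>W\<in>K. minor (\<lambda>(i, j). \<alpha> i j) (sorted_list_of_set S) W =
      (\<Sum>T\<in>A. c T * minor (\<lambda>(i, j). \<alpha> i j) (sorted_list_of_set T) W))"
proof -
  have finK: "finite K" using K by (simp add: simplicial_complex_def)
  have lookup: "Poly_Mapping.lookup (shift_vec N \<alpha> K T) W =
      (if W \<in> K then minor (\<lambda>(i, j). \<alpha> i j) (sorted_list_of_set T) W else 0)" for T W
  proof (cases "W \<in> K")
    case True
    then have "W \<subseteq> {1..N}" using face_subset_vertices[OF K] V by blast
    then show ?thesis
      using True by (simp add: shift_vec_def lookup_proj[OF finK] lookup_wedge_over_fvec)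
  qed (simp add: shift_vec_def lookup_proj[OF finK])
  have "shift_vec N \<alpha> K S = (\<Sum>T\<in>A. c T *\<^sub>R shift_vec N \<alpha> K T) \<longleftrightarrow>
      (\<forall>W\<in>K. minor (\<lambda>(i, j). \<alpha> i j) (sorted_list_of_set S) W =
        (\<Sum>T\<in>A. c T * minor (\<lambda>(i, j). \<alpha> i j) (sorted_list_of_set T) W))" (is "?l = ?r") for c
  proof -
    have "?l \<longleftrightarrow> (\<forall>W. Poly_Mapping.lookup (shift_vec N \<alpha> K S) W =
        Poly_Mapping.lookup (\<Sum>T\<in>A. c T *\<^sub>R shift_vec N \<alpha> K T) W)"
      by (simp only: poly_mapping_eq_iff fun_eq_iff)
    also have "\<dots> \<longleftrightarrow> ?r"
      by (simp only: lookup lookup_sum ext_lookup_scaleR) auto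
    finally show ?thesis .
  qed
  then show ?thesis
    unfolding mem_span_image_iff[OF assms(3)] by simp
qed

text \<open>Only rows up to the number of vertices and columns indexed by vertices enter. Both
  matrices contain this block and are algebraically independent on it, so span membership transfers;
  exchanging the matrices gives equality.\<close>

lemma alg_shift_subset_alg_shift:
  assumes K: "simplicial_complex K"
    and \<alpha>: "generic N \<alpha>" "vertices K \<subseteq> {1..N}" and \<beta>: "generic M \<beta>" "vertices K \<subseteq> {1..M}"
  shows "alg_shift N \<alpha> K \<subseteq> alg_shift M \<beta> K"
proof
  fix S assume S: "S \<in> alg_shift N \<alpha> K"
  let ?V = "vertices K" and ?I = "{1..card (vertices K)}"
  let ?A = "{S'. S' \<subseteq> ?I \<and> card S' = card S \<and> lex_less S' S}"
  have SI: "S \<subseteq> ?I" using S alg_shift_subset[OF K \<alpha>] by blast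
  have finA: "finite ?A" by (rule finite_subset[of _ "Pow ?I"]) auto
  have restrict: "alg_independent (?I \<times> ?V) (\<lambda>(i, j). \<gamma> i j)"
    if "generic L \<gamma>" "?V \<subseteq> {1..L}" for L \<gamma>
  proof -
    have "card ?V \<le> L" using card_mono[OF _ that(2)] by simp
    then have "?I \<times> ?V \<subseteq> {1..L} \<times> {1..L}" using that(2) by auto
    then show ?thesis
      using alg_independent_subset that(1) unfolding generic_def by blast
  qed
  have poly: "polyfun (?I \<times> ?V) (\<lambda>a. minor a (sorted_list_of_set T) W)" if "T \<subseteq> ?I" "W \<in> K" for T W
  proof (rule polyfun_minor)
    have "finite T" using that(1) finite_subset by blast
    then show "set (sorted_list_of_set T) \<times> W \<subseteq> ?I \<times> ?V"
      using that face_subset_vertices[OF K that(2)] by auto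
  qed
  have "shift_vec N \<alpha> K S \<in> span (shift_vec N \<alpha> K ` ?A)"
    if mem: "shift_vec M \<beta> K S \<in> span (shift_vec M \<beta> K ` ?A)"
    unfolding shift_vec_mem_span_iff[OF K \<alpha>(2) finA]
  proof (rule generic_combination_transfer[where v = "\<lambda>T W a. minor a (sorted_list_of_set T) W"
        and w = "\<lambda>W a. minor a (sorted_list_of_set S) W", OF finA])
    show "\<exists>c. \<forall>W\<in>K. minor (\<lambda>(i, j). \<beta> i j) (sorted_list_of_set S) W =
        (\<Sum>T\<in>?A. c T * minor (\<lambda>(i, j). \<beta> i j) (sorted_list_of_set T) W)"
      using mem unfolding shift_vec_mem_span_iff[OF K \<beta>(2) finA] .
    show "alg_independent (?I \<times> ?V) (\<lambda>(i, j). \<beta> i j)" "alg_independent (?I \<times> ?V) (\<lambda>(i, j). \<alpha> i j)"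
      using restrict \<alpha> \<beta> by blast+
    show "polyfun (?I \<times> ?V) (\<lambda>a. minor a (sorted_list_of_set S) W)" if "W \<in> K" for W
      by (rule poly[OF SI that])
    show "polyfun (?I \<times> ?V) (\<lambda>a. minor a (sorted_list_of_set T) W)" if "T \<in> ?A" "W \<in> K" for T W
      by (rule poly) (use that in auto)
  qed
  then show "S \<in> alg_shift M \<beta> K"
    using S unfolding alg_shift_iff_generic[OF K \<alpha>] alg_shift_iff_generic[OF K \<beta>] by blast
qed

section \<open>The union of two complexes along a simplex\<close>

text \<open>Rank-nullity on a finitely spanned subspace of a space that may have infinite dimension.
  A basis \<open>D\<close> of the kernel is extended to a basis \<open>E\<close>, and
  \<open>f\<close> is injective on the span of the added vectors \<open>C\<close>.\<close>

lemma dim_image_plus_kernel: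
  fixes f :: "'a :: real_vector \<Rightarrow> 'b :: real_vector"
  assumes lin: "linear f" and W: "subspace W" and B: "finite B" "W \<subseteq> span B"
  shows "dim W = dim (f ` W) + dim (W \<inter> {x. f x = 0})"
proof -
  let ?Z = "W \<inter> {x. f x = 0}"
  have Z: "subspace ?Z"
    using subspace_inter[OF W linear_subspace_kernel[OF lin]] .
  obtain D where D: "D \<subseteq> ?Z" "independent D" "?Z \<subseteq> span D"
    using maximal_independent_subset by blast
  obtain E where E: "D \<subseteq> E" "E \<subseteq> W" "independent E" "W \<subseteq> span E"
    using maximal_independent_subset_extend[of D W] D by blast
  have finE: "finite E"
    using independent_span_bound[OF B(1) E(3)] E(2) B(2) by blast
  define C where "C = E - D"
  have C: "C \<subseteq> W" "independent C" "finite C"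
    using E independent_mono[OF E(3)] finE by (auto simp: C_def)
  have spanC: "span C \<subseteq> W" using C(1) W by (rule span_minimal)
  have inj: "inj_on f (span C)"
  proof (rule inj_onI)
    fix x y assume xy: "x \<in> span C" "y \<in> span C" "f x = f y"
    then have 1: "x - y \<in> span C" by (intro span_diff)
    then have "x - y \<in> ?Z" using spanC xy(3) linear_diff[OF lin, of x y] by auto
    then have 2: "x - y \<in> span D" using D(3) by blast
    obtain c where c: "x - y = (\<Sum>t\<in>C. c t *\<^sub>R t)"
      using 1 mem_span_image_iff[OF C(3), of "x - y" "\<lambda>t. t"] by auto
    have finD: "finite D" using finE E(1) finite_subset by blast
    obtain d where d: "x - y = (\<Sum>t\<in>D. d t *\<^sub>R t)"
      using 2 mem_span_image_iff[OF finD, of "x - y" "\<lambda>t. t"] by auto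
    \<comment> \<open>The two expressions for \<open>x - y\<close>, by \<open>C\<close> and by
      \<open>D\<close>, subtract to a relation on the independent set \<open>E\<close>.\<close>
    define h where "h t = (if t \<in> C then c t else - d t)" for t
    have "(\<Sum>t\<in>C \<union> D. h t *\<^sub>R t) = (\<Sum>t\<in>C. h t *\<^sub>R t) + (\<Sum>t\<in>D. h t *\<^sub>R t)"
      using C(3) finD by (intro sum.union_disjoint) (auto simp: C_def)
    also have "(\<Sum>t\<in>C. h t *\<^sub>R t) = x - y"
      unfolding c by (intro sum.cong) (auto simp: h_def)
    also have "(\<Sum>t\<in>D. h t *\<^sub>R t) = - (x - y)"
      unfolding d sum_negf[symmetric] by (intro sum.cong) (auto simp: h_def C_def)
    finally have "(\<Sum>t\<in>C \<union> D. h t *\<^sub>R t) = 0" by simp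
    moreover have "C \<union> D = E" using E(1) by (auto simp: C_def)
    ultimately have "\<forall>t\<in>E. h t = 0"
      using E(3) finE unfolding independent_explicit_finite_subsets by blast
    then have "\<forall>t\<in>C. c t = 0" by (auto simp: h_def C_def)
    then have "x - y = 0" unfolding c by (intro sum.neutral) simp
    then show "x = y" by simp
  qed
  have "independent (f ` C)"
    using C(2) inj by (rule linear_independent_injective_image[OF lin])
  moreover have "f ` C \<subseteq> f ` W" using C(1) by blast
  moreover have "f ` W \<subseteq> span (f ` C)"
  proof -
    have "f ` W \<subseteq> span (f ` E)"
      unfolding linear_span_image[OF lin] using E(4) by blast
    also have "\<dots> \<subseteq> span (f ` C)"
    proof (intro span_minimal subspace_span image_subsetI)
      fix x assume "x \<in> E"
      show "f x \<in> span (f ` C)"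
      proof (cases "x \<in> D")
        case True
        then have "f x = 0" using D(1) by blast
        then show ?thesis by (simp add: span_zero)
      next
        case False
        then show ?thesis using \<open>x \<in> E\<close> by (intro span_base) (simp add: C_def)
      qed
    qed
    finally show ?thesis .
  qed
  ultimately have "dim (f ` W) = card (f ` C)"
    using basis_card_eq_dim by metis
  also have "\<dots> = card C"
    using inj span_superset by (intro card_image) (rule inj_on_subset)
  finally have "dim (f ` W) = card C" .
  moreover have "dim ?Z = card D" using basis_card_eq_dim[OF D(1,3,2)] by simp
  moreover have "dim W = card E" using basis_card_eq_dim[OF E(2,4,3)] by simp
  moreover have "card E = card C + card D"
    using card_Un_disjoint[of C D] C(3) finE E(1) finite_subset[OF E(1)]
    by (simp add: C_def Un_absorb1 Un_absorb2 Diff_disjoint inf_commute)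
  ultimately show ?thesis by simp
qed

section \<open>Counting over an initial segment\<close>

lemma proj_proj: "finite K \<Longrightarrow> X \<subseteq> K \<Longrightarrow> proj X (proj K x) = proj X x"
  unfolding proj_def[of X] by (intro sum.cong) (auto simp: lookup_proj)

lemma proj_cong_if_proj_0:
  assumes "finite K" "finite L" "proj K x = 0"
  shows "proj (K \<union> L) x = proj L x"
  using assms
  by (intro poly_mapping_eqI) (auto simp: lookup_proj proj_eq_0_iff)

lemma simplicial_complex_Pow:
  assumes "finite V"
  shows "simplicial_complex (Pow V)"
proof -
  have "finite S" if "S \<in> Pow V" for S using that assms finite_subset by blast
  moreover have "T \<in> Pow V" if "S \<in> Pow V" "T \<subseteq> S" for S T using that by blast
  ultimately show ?thesis
    unfolding simplicial_complex_def using assms by simp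
qed

lemma vertices_Pow: "vertices (Pow V) = V"
  by (simp add: vertices_def)

text \<open>What the dimension count needs of the index family: \<open>lower\<close> makes
  \<open>A\<close> an initial segment in degree \<open>d\<close>, and \<open>change_Max\<close> lets
  the last index be exchanged for any new one, even a larger one.\<close>

locale shift_family =
  fixes N :: nat and \<alpha> :: "nat \<Rightarrow> nat \<Rightarrow> real" and A :: "nat set set" and d :: nat
  assumes gen: "generic N \<alpha>"
    and A_subset: "T \<in> A \<Longrightarrow> T \<subseteq> {1..N}"
    and card_A: "T \<in> A \<Longrightarrow> card T = d"
    and d_pos: "d > 0"
    and lower: "T \<in> A \<Longrightarrow> T' \<subseteq> {1..N} \<Longrightarrow> card T' = card T \<Longrightarrow> lex_key N T' \<le> lex_key N T \<Longrightarrow> T' \<in> A"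
    and change_Max: "T \<in> A \<Longrightarrow> l \<in> {1..N} \<Longrightarrow> l \<notin> T - {Max T} \<Longrightarrow> insert l (T - {Max T}) \<in> A"
begin

abbreviation f :: "nat set \<Rightarrow> ext" where "f \<equiv> wedge_over (fvec N \<alpha>)"

definition W :: "ext set" where "W = span (f ` A)"

lemma subspace_W: "subspace W"
  by (simp add: W_def)

lemma finite_A: "finite A"
  by (rule finite_subset[of _ "Pow {1..N}"]) (use A_subset in auto)

lemma finite_mem_A: "T \<in> A \<Longrightarrow> finite T"
  using A_subset finite_subset by blast

lemma Max_mem_A: "T \<in> A \<Longrightarrow> Max T \<in> T"
  using finite_mem_A card_A d_pos by (intro Max_in) fastforce+

lemma fvec_in_span_range: "fvec N \<alpha> i \<in> span (range evec)"
  using fvec_in_span span_mono[of "evec ` {1..N}" "range evec"] by blast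

text \<open>Expanding \<open>evec j\<close> in the generic vectors gives products that differ from
  the one over \<open>T\<close> in the last factor only, and \<open>change_Max\<close> keeps these
  in \<open>W\<close>.\<close>

lemma change_Max_vector_in_W:
  assumes T: "T \<in> A" and j: "j \<in> {1..N}"
  shows "wedge_over ((fvec N \<alpha>)(Max T := evec j)) T \<in> W"
proof -
  let ?\<Phi> = "\<lambda>x. wedge_over ((fvec N \<alpha>)(Max T := x)) T"
  have lin: "linear ?\<Phi>"
    using T by (intro linear_wedge_over_update finite_mem_A Max_mem_A)
  \<comment> \<open>With \<open>V\<close> all of {1..N} no unit vectors remain on the right: the
    whole generic matrix is invertible.\<close>
  have "evec j \<in> span (fvec N \<alpha> ` {1..N})"
    using evec_in_span_generic[OF gen _ j, of "{1..N}"] by simp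
  then have "?\<Phi> (evec j) \<in> span (?\<Phi> ` fvec N \<alpha> ` {1..N})"
    unfolding linear_span_image[OF lin] by (rule imageI)
  moreover have "?\<Phi> (fvec N \<alpha> l) \<in> W" if l: "l \<in> {1..N}" for l
  proof -
    obtain c where c: "?\<Phi> (fvec N \<alpha> l) = c *\<^sub>R f (insert l (T - {Max T}))"
      "l \<in> T - {Max T} \<longrightarrow> c = 0"
      using wedge_over_replace[of "fvec N \<alpha>" T "Max T" l] fvec_in_span_range
        finite_mem_A[OF T] Max_mem_A[OF T] by blast
    show ?thesis
    proof (cases "l \<in> T - {Max T}")
      case True
      then have "c = 0" using c(2) by blast
      then show ?thesis unfolding c(1) W_def by (simp add: span_zero)
    next
      case False
      from change_Max[OF T l this] show ?thesis
        unfolding c(1) W_def by (intro span_scale span_base imageI)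
    qed
  qed
  then have "?\<Phi> ` fvec N \<alpha> ` {1..N} \<subseteq> W" by blast
  then have "span (?\<Phi> ` fvec N \<alpha> ` {1..N}) \<subseteq> W"
    by (rule span_minimal[OF _ subspace_W])
  ultimately show ?thesis by blast
qed

text \<open>Straightening only moves down in the order, so by \<open>lower\<close> every set that
  occurs is in \<open>A\<close>.\<close>

lemma W_straighten:
  assumes V: "V \<subseteq> {1..N}" and w: "w \<in> W"
  obtains p q where "w = p + q" "p \<in> span (f ` (A \<inter> Pow {1..card V}))"
    "q \<in> span {wedge_over ((fvec N \<alpha>)(Max T := evec j)) T | T j. T \<in> A \<and> j \<in> {1..N} - V}"
proof -
  let ?G = "f ` (A \<inter> Pow {1..card V})"
    and ?Z = "{wedge_over ((fvec N \<alpha>)(Max T := evec j)) T | T j. T \<in> A \<and> j \<in> {1..N} - V}"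
  have "card V \<le> N" using card_mono[OF _ V] by simp
  then have sub: "{1..card V} \<subseteq> {1..N}" by simp
  have "f T \<in> span (?G \<union> ?Z)" if T: "T \<in> A" for T
  proof (rule subsetD[OF span_mono wedge_over_straighten[OF gen V A_subset[OF T]]], rule Un_mono)
    show "f ` {T'. T' \<subseteq> {1..card V} \<and> card T' = card T \<and> lex_key N T' \<le> lex_key N T} \<subseteq> ?G"
      using lower[OF T] subset_trans[OF _ sub] by (intro image_mono) blast
    show "{wedge_over ((fvec N \<alpha>)(Max T' := evec j)) T' | T' j. T' \<subseteq> {1..N} \<and> T' \<noteq> {} \<and>
        card T' = card T \<and> lex_key N T' \<le> lex_key N T \<and> j \<in> {1..N} - V} \<subseteq> ?Z"
      using lower[OF T] by blast
  qed
  then have "W \<subseteq> span (?G \<union> ?Z)"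
    unfolding W_def by (intro span_minimal subspace_span image_subsetI)
  then show thesis
    using w that unfolding span_Un by blast
qed

lemma proj_W_eq_span: "proj K ` W = span (shift_vec N \<alpha> K ` A)"
  unfolding W_def linear_span_image[OF linear_proj, symmetric] image_image
  by (simp add: shift_vec_def[abs_def])

text \<open>For a member of \<open>A\<close>, its lexicographic predecessors of the same size are
  exactly its predecessors in \<open>A\<close>, so the shifted faces in \<open>A\<close> are the new
  directions of the greedy basis.\<close>

lemma dim_proj_W:
  assumes K: "simplicial_complex K"
  shows "dim (proj K ` W) = card (A \<inter> alg_shift N \<alpha> K)"
proof -
  let ?g = "shift_vec N \<alpha> K"
  have "A \<inter> alg_shift N \<alpha> K = {t \<in> A. ?g t \<notin> span (?g ` {t' \<in> A. lex_key N t' < lex_key N t})}"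
  proof -
    have "{S'. S' \<subseteq> {1..N} \<and> card S' = card t \<and> lex_less S' t} = {t' \<in> A. lex_key N t' < lex_key N t}"
      if t: "t \<in> A" for t
    proof (rule Collect_cong)
      fix S
      show "S \<subseteq> {1..N} \<and> card S = card t \<and> lex_less S t \<longleftrightarrow> S \<in> A \<and> lex_key N S < lex_key N t"
        using lex_less_iff_key[OF _ A_subset[OF t], of S] lower[OF t, of S] A_subset[of S]
          card_A[OF t] card_A[of S] by auto
    qed
    then show ?thesis
      using A_subset by (auto simp: alg_shift_iff[OF K])
  qed
  moreover have "inj_on (lex_key N) A"
    using inj_on_subset[OF inj_on_lex_key] A_subset by blast
  ultimately have "card (A \<inter> alg_shift N \<alpha> K) = dim (?g ` A)"
    using card_new_directions[OF finite_A, of "lex_key N" ?g] by simp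
  then show ?thesis by (simp add: proj_W_eq_span)
qed

lemma proj_outside:
  assumes "simplicial_complex K" "vertices K \<inter> J = {}"
    and q: "q \<in> span {wedge_over ((fvec N \<alpha>)(Max T := evec j)) T | T j. T \<in> A \<and> j \<in> J}"
  shows "proj K q = 0"
proof -
  have "span {wedge_over ((fvec N \<alpha>)(Max T := evec j)) T | T j. T \<in> A \<and> j \<in> J} \<subseteq> {x. proj K x = 0}"
  proof (rule span_minimal)
    show "{wedge_over ((fvec N \<alpha>)(Max T := evec j)) T | T j. T \<in> A \<and> j \<in> J} \<subseteq> {x. proj K x = 0}"
    proof clarify
      fix T j assume Tj: "T \<in> A" "j \<in> J"
      then have "j \<notin> vertices K" using assms(2) by blast
      then show "proj K (wedge_over ((fvec N \<alpha>)(Max T := evec j)) T) = 0"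
        using Tj(1) by (intro proj_wedge_over_eq_0[OF assms(1)] finite_mem_A Max_mem_A)
    qed
  qed (rule linear_subspace_kernel[OF linear_proj])
  with q show ?thesis by blast
qed

text \<open>On a simplex, straightening leaves only the f_T with \<open>T\<close> inside {1..card
  V}, and these remain independent there. This supplies the correction term of the formula.\<close>

lemma dim_proj_simplex:
  assumes V: "V \<subseteq> {1..N}"
  shows "dim (proj (Pow V) ` W) = card (A \<inter> Pow {1..card V})"
proof -
  let ?G = "A \<inter> Pow {1..card V}" and ?g = "shift_vec N \<alpha> (Pow V)"
  have finV: "finite V" using V finite_subset by blast
  note simplex = simplicial_complex_Pow[OF finV] vertices_Pow[of V]
  have g: "?g ` ?G = proj (Pow V) ` f ` ?G"
    by (simp add: shift_vec_def image_image)
  have "proj (Pow V) ` W = span (?g ` ?G)"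
  proof
    show "proj (Pow V) ` W \<subseteq> span (?g ` ?G)"
    proof (rule image_subsetI)
      fix w assume "w \<in> W"
      then obtain p q where pq: "w = p + q" "p \<in> span (f ` ?G)"
        "q \<in> span {wedge_over ((fvec N \<alpha>)(Max T := evec j)) T | T j. T \<in> A \<and> j \<in> {1..N} - V}"
        by (rule W_straighten[OF V])
      have "proj (Pow V) q = 0"
        by (rule proj_outside[OF simplex(1) _ pq(3)]) (simp add: simplex(2))
      then have "proj (Pow V) w = proj (Pow V) p"
        by (simp add: pq(1) linear_add[OF linear_proj])
      then show "proj (Pow V) w \<in> span (?g ` ?G)"
        unfolding g linear_span_image[OF linear_proj] using pq(2) by simp
    qed
    show "span (?g ` ?G) \<subseteq> proj (Pow V) ` W"
      unfolding proj_W_eq_span by (intro span_mono image_mono) blast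
  qed
  moreover have "independent (?g ` ?G)"
    by (rule independent_mono[OF generic_wedges_independent(2)[OF gen V]]) blast
  moreover have "card (?g ` ?G) = card ?G"
    by (intro card_image inj_on_subset[OF generic_wedges_independent(1)[OF gen V]]) blast
  ultimately show ?thesis
    by (simp add: dim_eq_card_independent)
qed

text \<open>If the last factor of a generator is \<open>e\<^sub>j\<close> with \<open>j \<notin> \<sigma>\<close>, then \<open>j\<close> is not a vertex of both
  \<open>K\<close> and \<open>L\<close>, so the generator dies in one of the two quotients.\<close>

lemma kernel_decomposition:
  assumes K: "simplicial_complex K" and L: "simplicial_complex L" and \<sigma>: "K \<inter> L = Pow \<sigma>"
    and V: "\<sigma> \<subseteq> {1..N}" and w: "w \<in> W" "proj (Pow \<sigma>) w = 0"
  obtains a b where "w = a + b" "a \<in> W" "b \<in> W" "proj K a = 0" "proj L b = 0"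
proof -
  have fin\<sigma>: "finite \<sigma>" using V finite_subset by blast
  note simplex = simplicial_complex_Pow[OF fin\<sigma>] vertices_Pow[of \<sigma>]
  let ?h = "\<lambda>J. {wedge_over ((fvec N \<alpha>)(Max T := evec j)) T | T j. T \<in> A \<and> j \<in> J}"
  let ?G = "A \<inter> Pow {1..card \<sigma>}"
  obtain p q where pq: "w = p + q" "p \<in> span (f ` ?G)" "q \<in> span (?h ({1..N} - \<sigma>))"
    by (rule W_straighten[OF V w(1)])
  have "proj (Pow \<sigma>) q = 0"
    by (rule proj_outside[OF simplex(1) _ pq(3)]) (simp add: simplex(2))
  then have p0: "proj (Pow \<sigma>) p = 0"
    using w(2) by (simp add: pq(1) linear_add[OF linear_proj])
  \<comment> \<open>The part \<open>p\<close> uses only products that are independent on \<sigma>,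
    so vanishing there makes all its coefficients 0.\<close>
  have "p = 0"
  proof -
    have finG: "finite ?G" using finite_A by blast
    obtain c where c: "p = (\<Sum>T\<in>?G. c T *\<^sub>R f T)"
      using pq(2) mem_span_image_iff[OF finG] by blast
    let ?g = "shift_vec N \<alpha> (Pow \<sigma>)"
    have inj: "inj_on ?g ?G"
      by (intro inj_on_subset[OF generic_wedges_independent(1)[OF gen V]]) blast
    have ind: "independent (?g ` ?G)"
      by (rule independent_mono[OF generic_wedges_independent(2)[OF gen V]]) blast
    have "0 = (\<Sum>T\<in>?G. c T *\<^sub>R ?g T)"
      using p0 by (simp add: c linear_sum[OF linear_proj] linear_scale[OF linear_proj] shift_vec_def)
    also have "\<dots> = (\<Sum>x\<in>?g ` ?G. c (the_inv_into ?G ?g x) *\<^sub>R x)"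
      unfolding sum.reindex[OF inj]
      by (rule sum.cong[OF refl]) (simp only: o_apply the_inv_into_f_f[OF inj])
    finally have sum0: "(\<Sum>x\<in>?g ` ?G. c (the_inv_into ?G ?g x) *\<^sub>R x) = 0" by (rule sym)
    have "c T = 0" if T: "T \<in> ?G" for T
      using independentD[OF ind finite_imageI[OF finG] order_refl sum0 imageI[OF T]]
      by (simp only: the_inv_into_f_f[OF inj T])
    then show "p = 0" unfolding c by (intro sum.neutral ballI) simp
  qed
  then have q: "w = q" using pq(1) by simp
  let ?JK = "{1..N} - vertices K" and ?JL = "{1..N} - vertices L"
  have "vertices K \<inter> vertices L = \<sigma>"
    using \<sigma> by (auto simp: vertices_def)
  then have "{1..N} - \<sigma> = ?JK \<union> ?JL" by blast
  then have "?h ({1..N} - \<sigma>) = ?h ?JK \<union> ?h ?JL" by auto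
  then have "w \<in> span (?h ?JK \<union> ?h ?JL)" using pq(3) q by simp
  then obtain a b where ab: "w = a + b" "a \<in> span (?h ?JK)" "b \<in> span (?h ?JL)"
    unfolding span_Un by blast
  have "?h J \<subseteq> W" if "J \<subseteq> {1..N}" for J
    using change_Max_vector_in_W that by blast
  then have "span (?h J) \<subseteq> W" if "J \<subseteq> {1..N}" for J
    using that by (intro span_minimal subspace_W)
  then have "a \<in> W" "b \<in> W" using ab(2,3) by blast+
  moreover have "proj K a = 0" by (rule proj_outside[OF K _ ab(2)]) simp
  moreover have "proj L b = 0" by (rule proj_outside[OF L _ ab(3)]) simp
  ultimately show thesis using that ab(1) by blast
qed

text \<open>Rank-nullity for the restrictions from \<open>K \<union> L\<close> to \<open>K\<close>
  and from \<open>L\<close> to \<open>Pow \<sigma>\<close>. The formula is the comparison of both,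
  once their kernels on the images of \<open>W\<close> are seen to be equal.\<close>

lemma card_alg_shift_Un:
  assumes K: "simplicial_complex K" and L: "simplicial_complex L" and \<sigma>: "K \<inter> L = Pow \<sigma>"
    and V: "\<sigma> \<subseteq> {1..N}"
  shows "card (A \<inter> alg_shift N \<alpha> (K \<union> L)) + card (A \<inter> Pow {1..card \<sigma>}) =
    card (A \<inter> alg_shift N \<alpha> K) + card (A \<inter> alg_shift N \<alpha> L)"
proof -
  have fin: "finite K" "finite L" using K L by (auto simp: simplicial_complex_def)
  have KL: "simplicial_complex (K \<union> L)" using K L by (auto simp: simplicial_complex_def)
  have dims: "dim (proj X ` W) = dim (proj Y ` W) + dim (proj X ` W \<inter> {x. proj Y x = 0})"
    if "finite X" "Y \<subseteq> X" for X Y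
  proof -
    have "proj Y ` proj X ` W = proj Y ` W"
      unfolding image_image using proj_proj[OF that] by simp
    then show ?thesis
      using dim_image_plus_kernel[OF linear_proj[of Y], of "proj X ` W" "shift_vec N \<alpha> X ` A"]
        finite_A by (simp add: proj_W_eq_span)
  qed
  have "proj (K \<union> L) ` W \<inter> {x. proj K x = 0} = proj L ` W \<inter> {x. proj (Pow \<sigma>) x = 0}"
  proof (intro equalityI subsetI)
    fix x assume "x \<in> proj (K \<union> L) ` W \<inter> {x. proj K x = 0}"
    then obtain w where w: "w \<in> W" "x = proj (K \<union> L) w" "proj K x = 0" by blast
    have "proj K w = 0" using w(2,3) proj_proj[of "K \<union> L" K w] fin by simp
    then have x: "x = proj L w" using proj_cong_if_proj_0[OF fin] w(2) by simp
    moreover have "proj (Pow \<sigma>) x = 0"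
    proof -
      have "proj (Pow \<sigma>) x = proj (Pow \<sigma>) w"
        unfolding x using \<sigma> by (intro proj_proj fin) blast
      also have "\<dots> = proj (Pow \<sigma>) (proj K w)"
        using \<sigma> by (intro proj_proj[symmetric] fin) blast
      finally show ?thesis using \<open>proj K w = 0\<close> linear_0[OF linear_proj] by simp
    qed
    ultimately show "x \<in> proj L ` W \<inter> {x. proj (Pow \<sigma>) x = 0}" using w(1) by blast
  next
    fix x assume "x \<in> proj L ` W \<inter> {x. proj (Pow \<sigma>) x = 0}"
    then obtain w where w: "w \<in> W" "x = proj L w" "proj (Pow \<sigma>) x = 0" by blast
    have "proj (Pow \<sigma>) w = 0" using w(2,3) proj_proj[OF fin(2), of "Pow \<sigma>" w] \<sigma> by auto
    then obtain a b where ab: "w = a + b" "a \<in> W" "b \<in> W" "proj K a = 0" "proj L b = 0"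
      by (rule kernel_decomposition[OF K L \<sigma> V w(1)])
    \<comment> \<open>As \<open>b\<close> vanishes on \<open>L\<close>, already \<open>a\<close>
      represents \<open>x\<close>; and \<open>a\<close> vanishes on \<open>K\<close>, so its
      projection to the union is supported in \<open>L\<close>.\<close>
    have "x = proj L a" using w(2) ab(1,5) by (simp add: linear_add[OF linear_proj])
    then have x: "x = proj (K \<union> L) a" using proj_cong_if_proj_0[OF fin ab(4)] by simp
    then have "proj K x = 0" using ab(4) proj_proj[of "K \<union> L" K a] fin by simp
    with x ab(2) show "x \<in> proj (K \<union> L) ` W \<inter> {x. proj K x = 0}" by blast
  qed
  moreover have "Pow \<sigma> \<subseteq> L" using \<sigma> by blast
  ultimately show ?thesis
    using dims[of "K \<union> L" K] dims[of L "Pow \<sigma>"] fin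
    by (simp add: dim_proj_W[OF K] dim_proj_W[OF L] dim_proj_W[OF KL] dim_proj_simplex[OF V])
qed

end

section \<open>Initial segments of sets\<close>

lemma init_props:
  assumes "finite T" "j \<le> card T"
  shows "init j T \<subseteq> T" "card (init j T) = j"
    and "x \<in> init j T \<Longrightarrow> y \<in> T \<Longrightarrow> y \<notin> init j T \<Longrightarrow> x < y"
proof -
  let ?xs = "sorted_list_of_set T"
  show "init j T \<subseteq> T"
    using set_take_subset[of j ?xs] assms(1) by (simp add: init_def)
  show "card (init j T) = j"
    using assms by (simp add: init_def distinct_card)
  assume x: "x \<in> init j T" and y: "y \<in> T" "y \<notin> init j T"
  have "sorted_wrt (<) (take j ?xs @ drop j ?xs)"
    by (simp add: strict_sorted_list_of_set)
  moreover have "y \<in> set (drop j ?xs)"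
  proof -
    have "y \<in> set (take j ?xs @ drop j ?xs)" using y(1) assms(1) by simp
    then show ?thesis using y(2) unfolding set_append init_def by blast
  qed
  ultimately show "x < y"
    using x unfolding init_def sorted_wrt_append by blast
qed

lemma init_insert_above:
  assumes "finite Q" "j \<le> card Q" "\<And>q. q \<in> Q \<Longrightarrow> q < x"
  shows "init j (insert x Q) = init j Q"
proof -
  have "x \<notin> Q" using assms(3) by blast
  have "sorted_wrt (<) (sorted_list_of_set Q @ [x])"
    using assms by (simp add: sorted_wrt_append strict_sorted_list_of_set)
  then have "sorted_list_of_set (set (sorted_list_of_set Q @ [x])) = sorted_list_of_set Q @ [x]"
    by (simp only: sorted_list_of_set.idem_if_sorted_distinct strict_sorted_iff)
  then have "sorted_list_of_set (insert x Q) = sorted_list_of_set Q @ [x]"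
    using assms(1) by simp
  then show ?thesis
    using assms(2) by (simp add: init_def)
qed

text \<open>Elements beyond the first \<open>j\<close> exceed those among them, so the first
  difference of the initial segments is also the first difference of the sets.\<close>

lemma lex_less_of_init:
  assumes fin: "finite T" "finite T'" and j: "j \<le> card T" "j \<le> card T'"
    and less: "lex_less (init j T) (init j T')"
  shows "lex_less T T'"
proof -
  let ?P = "init j T" and ?P' = "init j T'"
  note P = init_props[OF fin(1) j(1)] and P' = init_props[OF fin(2) j(2)]
  have finP: "finite ?P" "finite ?P'"
    using P(1) P'(1) fin finite_subset by blast+
  obtain p where p: "p \<in> ?P" "p \<notin> ?P'" "\<forall>x<p. x \<in> ?P \<longleftrightarrow> x \<in> ?P'"
    using less lex_less_iff[OF finP] by blast
  \<comment> \<open>Since both segments have \<open>j\<close> elements, \<open>?P'\<close> cannot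
    end before \<open>p\<close>: it would be a proper subset of \<open>?P\<close>.\<close>
  have *: "\<not> ?P' \<subseteq> {..<p}"
  proof
    assume "?P' \<subseteq> {..<p}"
    then have "?P' \<subset> ?P" using p by blast
    then have "card ?P' < card ?P" using finP by (intro psubset_card_mono)
    then show False using P(2) P'(2) by simp
  qed
  have below: "y \<in> ?P'" if "y \<in> T'" "y \<le> p" for y
  proof (rule ccontr)
    assume "y \<notin> ?P'"
    then have "x < y" if "x \<in> ?P'" for x using P'(3)[OF that \<open>y \<in> T'\<close>] by blast
    then have "?P' \<subseteq> {..<p}" using \<open>y \<le> p\<close> by fastforce
    with * show False ..
  qed
  have "x \<in> T \<longleftrightarrow> x \<in> T'" if x: "x < p" for x
  proof
    assume "x \<in> T"
    then have "x \<in> ?P" using P(3)[OF p(1), of x] x by force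
    then show "x \<in> T'" using p(3) x P'(1) by blast
  next
    assume "x \<in> T'"
    then have "x \<in> ?P'" using below x by simp
    then show "x \<in> T" using p(3) x P(1) by blast
  qed
  moreover have "p \<in> T" using p(1) P(1) by blast
  moreover have "p \<notin> T'" using below[of p] p(2) by blast
  ultimately show ?thesis
    using lex_less_iff[OF fin] by blast
qed

text \<open>As \<open>i > 0\<close>, the maximum is not among the \<open>k\<close> smallest
  elements. Exchanging it for a larger index keeps the initial segment, and exchanging it for a
  smaller one moves down in the order, where the family is closed.\<close>

lemma shift_family_init:
  assumes gen: "generic N \<alpha>" and i: "i > 0"
  shows "shift_family N \<alpha> {T. T \<subseteq> {1..N} \<and> card T = k + i \<and> lex_key N (init k T) < c} (k + i)"
    (is "shift_family N \<alpha> ?A _")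
proof
  have fin: "finite T" if "T \<subseteq> {1..N}" for T :: "nat set" using that finite_subset by blast
  have init: "init k T \<subseteq> {1..N}" if "T \<subseteq> {1..N}" "card T = k + i" for T
    using init_props(1)[OF fin[OF that(1)], of k] that by force
  show low: "T' \<in> ?A" if T: "T \<in> ?A" and T': "T' \<subseteq> {1..N}" "card T' = card T"
    and le: "lex_key N T' \<le> lex_key N T" for T T'
  proof -
    have T1: "T \<subseteq> {1..N}" "card T = k + i" using T by auto
    have card: "k \<le> card T" "k \<le> card T'" using T1 T' by auto
    have sub: "init k T \<subseteq> {1..N}" "init k T' \<subseteq> {1..N}" using init T1 T' by auto
    have "lex_key N (init k T') \<le> lex_key N (init k T)"
    proof (rule ccontr)
      assume "\<not> ?thesis"
      then have "lex_less (init k T) (init k T')"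
        using lex_less_iff_key[OF sub] by simp
      then have "lex_less T T'"
        using lex_less_of_init[OF fin[OF T1(1)] fin[OF T'(1)] card] by blast
      then show False using lex_less_iff_key[OF T1(1) T'(1)] le by simp
    qed
    then show ?thesis using T T' by auto
  qed
  show "insert l (T - {Max T}) \<in> ?A" if T: "T \<in> ?A" and l: "l \<in> {1..N}" "l \<notin> T - {Max T}" for T l
  proof -
    have T1: "T \<subseteq> {1..N}" "card T = k + i" using T by auto
    note finT = fin[OF T1(1)]
    have "T \<noteq> {}" using T1(2) i by auto
    then have M: "Max T \<in> T" using finT by simp
    let ?Q = "T - {Max T}"
    have cardQ: "card ?Q = k + i - 1" using M T1(2) finT by simp
    have T': "insert l ?Q \<subseteq> {1..N}" using T1(1) l(1) by blast
    have card': "card (insert l ?Q) = card T"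
      using l(2) finT cardQ T1(2) i by simp
    show ?thesis
    proof (cases "l < Max T")
      case True
      then have "l \<notin> T" using l(2) by auto
      from lex_less_replace[OF finT M this True]
      have "lex_key N (insert l ?Q) \<le> lex_key N T"
        unfolding lex_less_iff_key[OF T' T1(1)] by simp
      then show ?thesis by (rule low[OF T T' card'])
    next
      case False
      have Q: "q < Max T" if "q \<in> ?Q" for q
      proof -
        have "q \<le> Max T" using that finT by simp
        then show ?thesis using that by auto
      qed
      have k: "k \<le> card ?Q" using cardQ i by simp
      have "init k (insert l ?Q) = init k ?Q"
      proof (rule init_insert_above[OF _ k])
        show "q < l" if "q \<in> ?Q" for q using Q[OF that] False by simp
      qed (use finT in simp)
      moreover have "init k (insert (Max T) ?Q) = init k ?Q"
        using finT Q by (intro init_insert_above[OF _ k]) auto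
      moreover have "insert (Max T) ?Q = T" using M by blast
      ultimately have "init k (insert l ?Q) = init k T" by simp
      then show ?thesis using T T' card' by simp
    qed
  qed
qed (use gen i in auto)

text \<open>Keys are integers and injective, so raising the strict bound from the key of
  \<open>S\<close> by 1 admits exactly the sets with initial segment \<open>S\<close>.\<close>

lemma card_Iset_Int:
  fixes i :: nat
  assumes D: "D \<subseteq> Pow {1..n}" and n: "n \<le> N" and S: "S \<subseteq> {1..N}"
  defines "A \<equiv> \<lambda>c. {T. T \<subseteq> {1..N} \<and> card T = card S + i \<and> lex_key N (init (card S) T) < c}"
  shows "card (A (lex_key N S + 1) \<inter> D) = card (A (lex_key N S) \<inter> D) + card (Iset n i S \<inter> D)"
proof -
  let ?c = "lex_key N S"
  have sub: "{1..n} \<subseteq> {1..N}" using n by simp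
  have "A (?c + 1) \<inter> D = (A ?c \<inter> D) \<union> (Iset n i S \<inter> D)"
  proof (rule set_eqI)
    fix T
    show "T \<in> A (?c + 1) \<inter> D \<longleftrightarrow> T \<in> (A ?c \<inter> D) \<union> (Iset n i S \<inter> D)"
    proof (cases "T \<in> D \<and> card T = card S + i")
      case True
      then have T: "T \<subseteq> {1..n}" "T \<subseteq> {1..N}" using D sub by blast+
      have "finite T" using T(1) finite_subset by blast
      then have "init (card S) T \<subseteq> {1..N}"
        using init_props(1)[of T "card S"] T(2) True by force
      then have "lex_key N (init (card S) T) = ?c \<longleftrightarrow> init (card S) T = S"
        using inj_on_eq_iff[OF inj_on_lex_key, of "init (card S) T" N S] S by simp
      then have "lex_key N (init (card S) T) < ?c + 1 \<longleftrightarrow>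
          lex_key N (init (card S) T) < ?c \<or> init (card S) T = S" by auto
      then show ?thesis
        using True T by (simp add: A_def Iset_def del: atLeastAtMost_iff)
    next
      case False
      then show ?thesis unfolding A_def Iset_def by blast
    qed
  qed
  moreover have "(A ?c \<inter> D) \<inter> (Iset n i S \<inter> D) = {}"
    by (auto simp: A_def Iset_def)
  moreover have "finite D" using D by (rule finite_subset) simp
  ultimately show ?thesis
    by (simp add: card_Un_disjoint)
qed

section \<open>From initial segments to the sets with a fixed initial segment\<close>

theorem theorem1p2:
  fixes K L :: "nat set set" and \<sigma> S :: "nat set" and n i :: nat
    and N N\<^sub>K N\<^sub>L :: nat and \<alpha> \<alpha>\<^sub>K \<alpha>\<^sub>L :: "nat \<Rightarrow> nat \<Rightarrow> real"
  assumes "simplicial_complex K" and "simplicial_complex L"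
    and "K \<inter> L = Pow \<sigma>"
    and "vertices (K \<union> L) = {1..n}"
    and "vertices (K \<union> L) \<subseteq> {1..N}" and "generic N \<alpha>"
    and "vertices K \<subseteq> {1..N\<^sub>K}" and "generic N\<^sub>K \<alpha>\<^sub>K"
    and "vertices L \<subseteq> {1..N\<^sub>L}" and "generic N\<^sub>L \<alpha>\<^sub>L"
    and "i > 0" and "S \<subseteq> {1..n}"
  shows "int (card (Iset n i S \<inter> alg_shift N \<alpha> (K \<union> L))) =
           int (card (Iset n i S \<inter> alg_shift N\<^sub>K \<alpha>\<^sub>K K))
         + int (card (Iset n i S \<inter> alg_shift N\<^sub>L \<alpha>\<^sub>L L))
         - int (card (Iset n i S \<inter> Pow {1..card \<sigma>}))"
proof -
  note K = assms(1) and L = assms(2) and \<sigma> = assms(3) and gen = assms(6)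
  have KL: "simplicial_complex (K \<union> L)" using K L by (auto simp: simplicial_complex_def)
  have n: "n \<le> N"
    using card_mono[OF finite_atLeastAtMost, of "{1..n}" 1 N] assms(4,5) by simp
  have verts: "vertices K \<subseteq> {1..n}" "vertices L \<subseteq> {1..n}"
    using assms(4) by (auto simp: vertices_def)
  then have vertsN: "vertices K \<subseteq> {1..N}" "vertices L \<subseteq> {1..N}"
    using assms(4,5) by auto
  have \<sigma>n: "\<sigma> \<subseteq> {1..n}"
    using \<sigma> verts(1) face_subset_vertices[OF K, of \<sigma>] by blast
  \<comment> \<open>The three shifts may be taken with different matrices; the dimension count needs
    one, so those of \<open>K\<close> and \<open>L\<close> are moved to \<alpha>.\<close>
  have shiftK: "alg_shift N\<^sub>K \<alpha>\<^sub>K K = alg_shift N \<alpha> K"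
    using alg_shift_subset_alg_shift[OF K] assms(7,8) gen vertsN(1) by blast
  have shiftL: "alg_shift N\<^sub>L \<alpha>\<^sub>L L = alg_shift N \<alpha> L"
    using alg_shift_subset_alg_shift[OF L] assms(9,10) gen vertsN(2) by blast
  have below: "Pow {1..card V} \<subseteq> Pow {1..n}" if "V \<subseteq> {1..n}" for V
    using card_mono[OF _ that] by auto
  let ?A = "\<lambda>c. {T. T \<subseteq> {1..N} \<and> card T = card S + i \<and> lex_key N (init (card S) T) < c}"
  let ?c = "lex_key N S"
  have count: "card (?A (?c + 1) \<inter> D) = card (?A ?c \<inter> D) + card (Iset n i S \<inter> D)"
    if "D \<subseteq> Pow {1..n}" for D
    using that n assms(12) by (intro card_Iset_Int) auto
  have Un: "card (?A c \<inter> alg_shift N \<alpha> (K \<union> L)) + card (?A c \<inter> Pow {1..card \<sigma>}) =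
      card (?A c \<inter> alg_shift N \<alpha> K) + card (?A c \<inter> alg_shift N \<alpha> L)" for c
    using \<sigma>n n by (intro shift_family.card_alg_shift_Un[OF shift_family_init[OF gen assms(11)] K L \<sigma>]) auto
  \<comment> \<open>The families are indexed by subsets of {1..N} but \<open>Iset\<close> by subsets
    of {1..n}; the difference disappears because all four complexes live in {1..n}.\<close>
  have D: "alg_shift N \<alpha> (K \<union> L) \<subseteq> Pow {1..n}"
    "alg_shift N \<alpha> K \<subseteq> Pow {1..n}" "alg_shift N \<alpha> L \<subseteq> Pow {1..n}" "Pow {1..card \<sigma>} \<subseteq> Pow {1..n}"
    using alg_shift_subset[OF KL gen assms(5)] alg_shift_subset[OF K gen vertsN(1)]
      alg_shift_subset[OF L gen vertsN(2)] below[of "vertices (K \<union> L)"] below[OF verts(1)]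
      below[OF verts(2)] below[OF \<sigma>n] assms(4) by auto
  \<comment> \<open>The additive formula at the two consecutive bounds, subtracted.\<close>
  show ?thesis
    unfolding shiftK shiftL
    using Un[of "?c + 1"] Un[of ?c] count[OF D(1)] count[OF D(2)] count[OF D(3)] count[OF D(4)]
    by linarith
qed

end
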